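(* Let $(L,[-,-],N,\alpha,\beta)$ be an involutive Nijenhuis BiHom-Lie algebra and let $S:L\to L$ be a linear map that is adjoint-admissible to it. If $r\in L\otimes L$ is a solution of the $S$-Nijenhuis classical BiHom Yang-Baxter equation, that is, $\operatorname{CBHYB}(r)=0$ and $(S\otimes\mathrm{id}-\mathrm{id}\otimes N)(r)=0$, and $r$ satisfies $$r=-\tau(r),\qquad(\alpha\otimes\alpha)r=r,\qquad(\beta\otimes\beta)r=r,$$ then $(L,[-,-],N,\Delta_r,S,\alpha,\beta)$ is a Nijenhuis BiHom-Lie bialgebra, where $\Delta_r(x)=(\mathrm{ad}_x\otimes\beta+\beta\otimes\mathrm{ad}_{\alpha^{-1}\beta(x)})r$.
   Context: All vector spaces are finite-dimensional over a field $\mathbf k$; $\langle\cdot,\cdot\rangle$ is the natural pairing of a space with its dual; $\tau(x\otimes y)=y\otimes x$; $\mathrm{ad}_x(y)=[x,y]$. **BiHom-Lie algebra** $(L,[-,-],\alpha,\beta)$: a vector space $L$, a bilinear map $[-,-]$ and two commuting linear maps $\alpha,\beta$ on $L$ with $\alpha([x,y])=[\alpha(x),\alpha(y)]$, $\beta([x,y])=[\beta(x),\beta(y)]$, $[\beta(x),\alpha(y)]=-[\beta(y),\alpha(x)]$ and $[\beta^2(x),[\beta(y),\alpha(z)]]+[\beta^2(y),[\beta(z),\alpha(x)]]+[\beta^2(z),[\beta(x),\alpha(y)]]=0$. It is **involutive** if $\alpha^2=\beta^2=\mathrm{id}_L$. **Nijenhuis BiHom-Lie algebra** $(L,[-,-],N,\alpha,\beta)$: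 a BiHom-Lie algebra with a linear map $N:L\to L$ commuting with $\alpha$ and $\beta$ such that $[N(x),N(y)]=N([N(x),y]+[x,N(y)])-N^2([x,y])$. It is involutive if the underlying BiHom-Lie algebra is. **CBHYBE.** Write $r=r_1\otimes r_2$ (summation suppressed) and let $\bar r_1\otimes\bar r_2$ be a second copy of $r$. Then $$\operatorname{CBHYB}(r)=[r_1,\alpha^{-1}\beta(\bar r_1)]\otimes\beta(r_2)\otimes\beta(\bar r_2)+\beta(r_1)\otimes[r_2,\alpha^{-1}\beta(\bar r_1)]\otimes\beta(\bar r_2)+\beta(r_1)\otimes\beta(\bar r_1)\otimes[r_2,\alpha^{-1}\beta(\bar r_2)].$$ **BiHom-Lie coalgebra** $(L,\Delta,\alpha,\beta)$: commuting linear maps $\alpha,\beta$ and a linear map $\Delta:L\to L\otimes L$ with $\Delta\alpha=(\alpha\otimes\alpha)\Delta$, $\Delta\beta=(\beta\otimes\beta)\Delta$, $(\beta\otimes\alpha)\Delta+\tau(\beta\otimes\alpha)\Delta=0$, and, with $J=(\mathrm{id}\otimes\beta\otimes\alpha)(\beta^2\otimes\Delta)\Delta$, $J+(\tau\otimes\mathrm{id})(\mathrm{id}\otimes\tau)J+(\mathrm{id}\otimes\tau)(\tau\otimes\mathrm{id})J=0$. **BiHom-Lie bialgebra** $(L,[-,-],\Delta,\alpha,\beta)$: $(L,[-,-],\alpha,\beta)$ is a BiHom-Lie algebra, $(L,\Delta,\alpha,\beta)$ is a BiHom-Lie coalgebra, $\alpha$ is invertible, and for all $x,y\in L$ $$\Delta([\alpha^{-1}\beta(x),y])=(\mathrm{ad}_{\beta(x)}\otimes\beta+\beta\otimes\mathrm{ad}_{\alpha^{-1}\beta^2(x)})\Delta(y)-(\mathrm{ad}_{\beta(y)}\otimes\beta+\beta\otimes\mathrm{ad}_{\alpha^{-1}\beta^2(y)})\Delta(x).$$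 **Nijenhuis BiHom-Lie coalgebra** $(L,\Delta,S,\alpha,\beta)$: a BiHom-Lie coalgebra with a linear map $S:L\to L$ such that $(S\otimes S)\Delta+\Delta S^2=(S\otimes\mathrm{id})\Delta S+(\mathrm{id}\otimes S)\Delta S$. **Representations.** A representation of a BiHom-Lie algebra $(L,[-,-],\alpha,\beta)$ is $(V,\rho,p,q)$ with $p,q$ commuting linear maps on $V$ and $\rho:L\to\mathfrak{gl}(V)$ linear such that $p(\rho(x)v)=\rho(\alpha(x))p(v)$, $q(\rho(x)v)=\rho(\beta(x))q(v)$, $\rho([\beta(x),y])q(v)=\rho(\alpha\beta(x))\rho(y)v-\rho(\beta(y))\rho(\alpha(x))v$. A representation of a Nijenhuis BiHom-Lie algebra $(L,[-,-],N,\alpha,\beta)$ is $(V,\rho,\eta,p,q)$ where $(V,\rho,p,q)$ is a representation of the BiHom-Lie algebra and $\eta:V\to V$ is linear, commutes with $p$ and $q$, and satisfies $\rho(N(x))\eta(v)=\eta(\rho(N(x))v)+\eta(\rho(x)\eta(v))-\eta^2(\rho(x)v)$. **Duals and adjoint-admissibility.** For a linear map $f$, $\langle f^*(a^* ),x\rangle=\langle a^*,f(x)\rangle$; $\langle\mathrm{ad}^*(x)b^*,y\rangle=-\langle b^*,[x,y]\rangle$; $\Delta^*:L^*\otimes L^*\to L^*$ is $\langle\Delta^*(a^*\otimes b^* ),x\rangle=\langle a^*\otimes b^*,\Delta(x)\rangle$. A linear map $S:L\to L$ is adjoint-admissible to an involutive Nijenhuis BiHom-Lie algebra $(L,[-,-],N,\alpha,\beta)$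 if $(L^*,\mathrm{ad}^*,S^*,\alpha^*,\beta^* )$ is a representation of it and $S([N(x),y])+[x,S^2(y)]=[N(x),S(y)]+S([x,S(y)])$ for all $x,y$. **Nijenhuis BiHom-Lie bialgebra** $(L,[-,-],N,\Delta,S,\alpha,\beta)$: (i) $(L,[-,-],\Delta,\alpha,\beta)$ is a BiHom-Lie bialgebra; (ii) $(L,[-,-],N,\alpha,\beta)$ is an involutive Nijenhuis BiHom-Lie algebra; (iii) $(L,\Delta,S,\alpha,\beta)$ is a Nijenhuis BiHom-Lie coalgebra; (iv) $S$ is adjoint-admissible to $(L,[-,-],N,\alpha,\beta)$; (v) $N^*$ is adjoint-admissible to $(L^*,\Delta^*,S^*,\alpha^*,\beta^* )$. *)

theory Defs
  imports Complex_Main "HOL-Library.Function_Algebras"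
begin

text \<open>
  A vector space over a field is a pair \<open>s\<close>, \<open>V\<close>: a scalar multiplication \<open>s\<close> on a type and a
  subspace \<open>V\<close> of that type.  Carriers are needed because the dual of \<open>V\<close> is a proper subset of a
  function type.  Values of structure maps outside the carriers are irrelevant.
\<close>

definition fd_space :: "('k::field \<Rightarrow> 'v::ab_group_add \<Rightarrow> 'v) \<Rightarrow> 'v set \<Rightarrow> bool" where
  "fd_space s V \<longleftrightarrow> vector_space s \<and> module.subspace s V \<and> (\<exists>B. finite B \<and> module.span s B = V)"

definition lin_map :: "('k::field \<Rightarrow> 'v::ab_group_add \<Rightarrow> 'v) \<Rightarrow> 'v set \<Rightarrow>
    ('k \<Rightarrow> 'w::ab_group_add \<Rightarrow> 'w) \<Rightarrow> 'w set \<Rightarrow> ('v \<Rightarrow> 'w) \<Rightarrow> bool" where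
  "lin_map s V t W f \<longleftrightarrow> (\<forall>x\<in>V. f x \<in> W) \<and> (\<forall>x\<in>V. \<forall>y\<in>V. f (x + y) = f x + f y) \<and>
     (\<forall>c. \<forall>x\<in>V. f (s c x) = t c (f x))"

abbreviation lin_endo :: "('k::field \<Rightarrow> 'v::ab_group_add \<Rightarrow> 'v) \<Rightarrow> 'v set \<Rightarrow> ('v \<Rightarrow> 'v) \<Rightarrow> bool" where
  "lin_endo s V \<equiv> lin_map s V s V"

definition bilin_map :: "('k::field \<Rightarrow> 'v::ab_group_add \<Rightarrow> 'v) \<Rightarrow> 'v set \<Rightarrow>
    ('k \<Rightarrow> 'w::ab_group_add \<Rightarrow> 'w) \<Rightarrow> 'w set \<Rightarrow>
    ('k \<Rightarrow> 'u::ab_group_add \<Rightarrow> 'u) \<Rightarrow> 'u set \<Rightarrow> ('v \<Rightarrow> 'w \<Rightarrow> 'u) \<Rightarrow> bool" where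
  "bilin_map s V t W u U f \<longleftrightarrow>
     (\<forall>x\<in>V. lin_map t W u U (f x)) \<and> (\<forall>y\<in>W. lin_map s V u U (\<lambda>x. f x y))"

abbreviation bilin_form :: "('k::field \<Rightarrow> 'v::ab_group_add \<Rightarrow> 'v) \<Rightarrow> 'v set \<Rightarrow> ('v \<Rightarrow> 'v \<Rightarrow> 'k) \<Rightarrow> bool" where
  "bilin_form s V \<equiv> bilin_map s V s V (*) UNIV"

definition trilin_form :: "('k::field \<Rightarrow> 'v::ab_group_add \<Rightarrow> 'v) \<Rightarrow> 'v set \<Rightarrow> ('v \<Rightarrow> 'v \<Rightarrow> 'v \<Rightarrow> 'k) \<Rightarrow> bool" where
  "trilin_form s V T \<longleftrightarrow>
     (\<forall>x\<in>V. bilin_form s V (T x)) \<and> (\<forall>y\<in>V. \<forall>z\<in>V. lin_map s V (*) UNIV (\<lambda>x. T x y z))"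

definition fscale :: "'k::field \<Rightarrow> ('a \<Rightarrow> 'k) \<Rightarrow> 'a \<Rightarrow> 'k" where
  "fscale c f = (\<lambda>x. c * f x)"

text \<open>Linear functionals on \<open>V\<close> are represented uniquely by extending them by \<open>0\<close> outside \<open>V\<close>.\<close>

definition dual :: "('k::field \<Rightarrow> 'v::ab_group_add \<Rightarrow> 'v) \<Rightarrow> 'v set \<Rightarrow> ('v \<Rightarrow> 'k) set" where
  "dual s V = {a. lin_map s V (*) UNIV a \<and> (\<forall>x. x \<notin> V \<longrightarrow> a x = 0)}"

definition dual_map :: "'v set \<Rightarrow> ('v \<Rightarrow> 'v) \<Rightarrow> ('v \<Rightarrow> 'k::field) \<Rightarrow> 'v \<Rightarrow> 'k" where
  "dual_map V f a = (\<lambda>x. if x \<in> V then a (f x) else 0)"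

text \<open>
  The pure tensor \<open>x \<otimes> y\<close> is the functional \<open>B \<mapsto> B(x,y)\<close> on bilinear forms \<open>B\<close> on \<open>V\<close>, set to \<open>0\<close>
  on functions that are not bilinear so that tensors are determined by their values on bilinear
  forms; \<open>V \<otimes> V\<close> is the linear span of the pure tensors.  Thus for \<open>r = \<Sum> r1 \<otimes> r2\<close> and \<open>B\<close> bilinear,
  \<open>r (\<lambda>r1 r2. B r1 r2) = \<Sum> B(r1,r2)\<close>, which is how Sweedler notation is rendered below.
  Tensors of order three are treated in the same way, by trilinear forms.
\<close>

type_synonym ('k, 'v) tensor2 = "('v \<Rightarrow> 'v \<Rightarrow> 'k) \<Rightarrow> 'k"
type_synonym ('k, 'v) tensor3 = "('v \<Rightarrow> 'v \<Rightarrow> 'v \<Rightarrow> 'k) \<Rightarrow> 'k"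

definition pure2 :: "('k::field \<Rightarrow> 'v::ab_group_add \<Rightarrow> 'v) \<Rightarrow> 'v set \<Rightarrow> 'v \<Rightarrow> 'v \<Rightarrow> ('k, 'v) tensor2" where
  "pure2 s V x y = (\<lambda>B. if bilin_form s V B then B x y else 0)"

definition pure3 :: "('k::field \<Rightarrow> 'v::ab_group_add \<Rightarrow> 'v) \<Rightarrow> 'v set \<Rightarrow> 'v \<Rightarrow> 'v \<Rightarrow> 'v \<Rightarrow> ('k, 'v) tensor3" where
  "pure3 s V x y z = (\<lambda>T. if trilin_form s V T then T x y z else 0)"

definition tensor_square :: "('k::field \<Rightarrow> 'v::ab_group_add \<Rightarrow> 'v) \<Rightarrow> 'v set \<Rightarrow> ('k, 'v) tensor2 set" where
  "tensor_square s V = module.span fscale {pure2 s V x y | x y. x \<in> V \<and> y \<in> V}"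

definition tmap2 :: "('k::field \<Rightarrow> 'v::ab_group_add \<Rightarrow> 'v) \<Rightarrow> 'v set \<Rightarrow> ('v \<Rightarrow> 'v) \<Rightarrow> ('v \<Rightarrow> 'v) \<Rightarrow>
    ('k, 'v) tensor2 \<Rightarrow> ('k, 'v) tensor2" where
  "tmap2 s V f g t = (\<lambda>B. if bilin_form s V B then t (\<lambda>x y. B (f x) (g y)) else 0)"

definition tmap3 :: "('k::field \<Rightarrow> 'v::ab_group_add \<Rightarrow> 'v) \<Rightarrow> 'v set \<Rightarrow> ('v \<Rightarrow> 'v) \<Rightarrow> ('v \<Rightarrow> 'v) \<Rightarrow> ('v \<Rightarrow> 'v) \<Rightarrow>
    ('k, 'v) tensor3 \<Rightarrow> ('k, 'v) tensor3" where
  "tmap3 s V f g h t = (\<lambda>T. if trilin_form s V T then t (\<lambda>x y z. T (f x) (g y) (h z)) else 0)"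

text \<open>\<open>f \<otimes> \<Delta> : V \<otimes> V \<rightarrow> V \<otimes> V \<otimes> V\<close> for \<open>f : V \<rightarrow> V\<close> and \<open>\<Delta> : V \<rightarrow> V \<otimes> V\<close>.\<close>

definition tmap_cobr :: "('k::field \<Rightarrow> 'v::ab_group_add \<Rightarrow> 'v) \<Rightarrow> 'v set \<Rightarrow> ('v \<Rightarrow> 'v) \<Rightarrow>
    ('v \<Rightarrow> ('k, 'v) tensor2) \<Rightarrow> ('k, 'v) tensor2 \<Rightarrow> ('k, 'v) tensor3" where
  "tmap_cobr s V f \<Delta> t =
     (\<lambda>T. if trilin_form s V T then t (\<lambda>x y. \<Delta> y (\<lambda>u v. T (f x) u v)) else 0)"

definition flip2 :: "('k, 'v) tensor2 \<Rightarrow> ('k, 'v) tensor2" where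
  "flip2 t = (\<lambda>B. t (\<lambda>x y. B y x))"

definition flip12 :: "('k, 'v) tensor3 \<Rightarrow> ('k, 'v) tensor3" where
  "flip12 t = (\<lambda>T. t (\<lambda>x y z. T y x z))"

definition flip23 :: "('k, 'v) tensor3 \<Rightarrow> ('k, 'v) tensor3" where
  "flip23 t = (\<lambda>T. t (\<lambda>x y z. T x z y))"

definition bihom_lie_algebra :: "('k::field \<Rightarrow> 'v::ab_group_add \<Rightarrow> 'v) \<Rightarrow> 'v set \<Rightarrow>
    ('v \<Rightarrow> 'v \<Rightarrow> 'v) \<Rightarrow> ('v \<Rightarrow> 'v) \<Rightarrow> ('v \<Rightarrow> 'v) \<Rightarrow> bool" where
  "bihom_lie_algebra s L br \<alpha> \<beta> \<longleftrightarrow>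
     fd_space s L \<and> bilin_map s L s L s L br \<and> lin_endo s L \<alpha> \<and> lin_endo s L \<beta> \<and>
     (\<forall>x\<in>L. \<alpha> (\<beta> x) = \<beta> (\<alpha> x)) \<and>
     (\<forall>x\<in>L. \<forall>y\<in>L. \<alpha> (br x y) = br (\<alpha> x) (\<alpha> y)) \<and>
     (\<forall>x\<in>L. \<forall>y\<in>L. \<beta> (br x y) = br (\<beta> x) (\<beta> y)) \<and>
     (\<forall>x\<in>L. \<forall>y\<in>L. br (\<beta> x) (\<alpha> y) = - br (\<beta> y) (\<alpha> x)) \<and>
     (\<forall>x\<in>L. \<forall>y\<in>L. \<forall>z\<in>L.
        br (\<beta> (\<beta> x)) (br (\<beta> y) (\<alpha> z)) + br (\<beta> (\<beta> y)) (br (\<beta> z) (\<alpha> x))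
        + br (\<beta> (\<beta> z)) (br (\<beta> x) (\<alpha> y)) = 0)"

definition nijenhuis_bihom_lie_algebra :: "('k::field \<Rightarrow> 'v::ab_group_add \<Rightarrow> 'v) \<Rightarrow> 'v set \<Rightarrow>
    ('v \<Rightarrow> 'v \<Rightarrow> 'v) \<Rightarrow> ('v \<Rightarrow> 'v) \<Rightarrow> ('v \<Rightarrow> 'v) \<Rightarrow> ('v \<Rightarrow> 'v) \<Rightarrow> bool" where
  "nijenhuis_bihom_lie_algebra s L br N \<alpha> \<beta> \<longleftrightarrow>
     bihom_lie_algebra s L br \<alpha> \<beta> \<and> lin_endo s L N \<and>
     (\<forall>x\<in>L. N (\<alpha> x) = \<alpha> (N x)) \<and> (\<forall>x\<in>L. N (\<beta> x) = \<beta> (N x)) \<and>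
     (\<forall>x\<in>L. \<forall>y\<in>L. br (N x) (N y) = N (br (N x) y + br x (N y)) - N (N (br x y)))"

definition involutive_nijenhuis_bihom_lie_algebra :: "('k::field \<Rightarrow> 'v::ab_group_add \<Rightarrow> 'v) \<Rightarrow> 'v set \<Rightarrow>
    ('v \<Rightarrow> 'v \<Rightarrow> 'v) \<Rightarrow> ('v \<Rightarrow> 'v) \<Rightarrow> ('v \<Rightarrow> 'v) \<Rightarrow> ('v \<Rightarrow> 'v) \<Rightarrow> bool" where
  "involutive_nijenhuis_bihom_lie_algebra s L br N \<alpha> \<beta> \<longleftrightarrow>
     nijenhuis_bihom_lie_algebra s L br N \<alpha> \<beta> \<and> (\<forall>x\<in>L. \<alpha> (\<alpha> x) = x) \<and> (\<forall>x\<in>L. \<beta> (\<beta> x) = x)"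

definition bihom_representation :: "('k::field \<Rightarrow> 'v::ab_group_add \<Rightarrow> 'v) \<Rightarrow> 'v set \<Rightarrow>
    ('v \<Rightarrow> 'v \<Rightarrow> 'v) \<Rightarrow> ('v \<Rightarrow> 'v) \<Rightarrow> ('v \<Rightarrow> 'v) \<Rightarrow>
    ('k \<Rightarrow> 'w::ab_group_add \<Rightarrow> 'w) \<Rightarrow> 'w set \<Rightarrow> ('v \<Rightarrow> 'w \<Rightarrow> 'w) \<Rightarrow> ('w \<Rightarrow> 'w) \<Rightarrow> ('w \<Rightarrow> 'w) \<Rightarrow> bool" where
  "bihom_representation s L br \<alpha> \<beta> t V \<rho> p q \<longleftrightarrow>
     bihom_lie_algebra s L br \<alpha> \<beta> \<and> fd_space t V \<and>
     bilin_map s L t V t V \<rho> \<and> lin_endo t V p \<and> lin_endo t V q \<and>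
     (\<forall>v\<in>V. p (q v) = q (p v)) \<and>
     (\<forall>x\<in>L. \<forall>v\<in>V. p (\<rho> x v) = \<rho> (\<alpha> x) (p v)) \<and>
     (\<forall>x\<in>L. \<forall>v\<in>V. q (\<rho> x v) = \<rho> (\<beta> x) (q v)) \<and>
     (\<forall>x\<in>L. \<forall>y\<in>L. \<forall>v\<in>V.
        \<rho> (br (\<beta> x) y) (q v) = \<rho> (\<alpha> (\<beta> x)) (\<rho> y v) - \<rho> (\<beta> y) (\<rho> (\<alpha> x) v))"

definition nijenhuis_representation :: "('k::field \<Rightarrow> 'v::ab_group_add \<Rightarrow> 'v) \<Rightarrow> 'v set \<Rightarrow>
    ('v \<Rightarrow> 'v \<Rightarrow> 'v) \<Rightarrow> ('v \<Rightarrow> 'v) \<Rightarrow> ('v \<Rightarrow> 'v) \<Rightarrow> ('v \<Rightarrow> 'v) \<Rightarrow>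
    ('k \<Rightarrow> 'w::ab_group_add \<Rightarrow> 'w) \<Rightarrow> 'w set \<Rightarrow> ('v \<Rightarrow> 'w \<Rightarrow> 'w) \<Rightarrow> ('w \<Rightarrow> 'w) \<Rightarrow> ('w \<Rightarrow> 'w) \<Rightarrow> ('w \<Rightarrow> 'w) \<Rightarrow> bool"
  where
  "nijenhuis_representation s L br N \<alpha> \<beta> t V \<rho> \<eta> p q \<longleftrightarrow>
     nijenhuis_bihom_lie_algebra s L br N \<alpha> \<beta> \<and>
     bihom_representation s L br \<alpha> \<beta> t V \<rho> p q \<and> lin_endo t V \<eta> \<and>
     (\<forall>v\<in>V. \<eta> (p v) = p (\<eta> v)) \<and> (\<forall>v\<in>V. \<eta> (q v) = q (\<eta> v)) \<and>
     (\<forall>x\<in>L. \<forall>v\<in>V. \<rho> (N x) (\<eta> v) = \<eta> (\<rho> (N x) v) + \<eta> (\<rho> x (\<eta> v)) - \<eta> (\<eta> (\<rho> x v)))"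

definition coad :: "'v set \<Rightarrow> ('v \<Rightarrow> 'v \<Rightarrow> 'v) \<Rightarrow> 'v \<Rightarrow> ('v \<Rightarrow> 'k::field) \<Rightarrow> 'v \<Rightarrow> 'k" where
  "coad L br x b = (\<lambda>y. if y \<in> L then - b (br x y) else 0)"

definition adjoint_admissible :: "('k::field \<Rightarrow> 'v::ab_group_add \<Rightarrow> 'v) \<Rightarrow> 'v set \<Rightarrow>
    ('v \<Rightarrow> 'v \<Rightarrow> 'v) \<Rightarrow> ('v \<Rightarrow> 'v) \<Rightarrow> ('v \<Rightarrow> 'v) \<Rightarrow> ('v \<Rightarrow> 'v) \<Rightarrow> ('v \<Rightarrow> 'v) \<Rightarrow> bool" where
  "adjoint_admissible s L br N \<alpha> \<beta> S \<longleftrightarrow>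
     involutive_nijenhuis_bihom_lie_algebra s L br N \<alpha> \<beta> \<and> lin_endo s L S \<and>
     nijenhuis_representation s L br N \<alpha> \<beta> fscale (dual s L)
       (coad L br) (dual_map L S) (dual_map L \<alpha>) (dual_map L \<beta>) \<and>
     (\<forall>x\<in>L. \<forall>y\<in>L. S (br (N x) y) + br x (S (S y)) = br (N x) (S y) + S (br x (S y)))"

definition cojac :: "('k::field \<Rightarrow> 'v::ab_group_add \<Rightarrow> 'v) \<Rightarrow> 'v set \<Rightarrow>
    ('v \<Rightarrow> ('k, 'v) tensor2) \<Rightarrow> ('v \<Rightarrow> 'v) \<Rightarrow> ('v \<Rightarrow> 'v) \<Rightarrow> 'v \<Rightarrow> ('k, 'v) tensor3" where
  "cojac s L \<Delta> \<alpha> \<beta> x = tmap3 s L id \<beta> \<alpha> (tmap_cobr s L (\<beta> \<circ> \<beta>) \<Delta> (\<Delta> x))"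

definition bihom_lie_coalgebra :: "('k::field \<Rightarrow> 'v::ab_group_add \<Rightarrow> 'v) \<Rightarrow> 'v set \<Rightarrow>
    ('v \<Rightarrow> ('k, 'v) tensor2) \<Rightarrow> ('v \<Rightarrow> 'v) \<Rightarrow> ('v \<Rightarrow> 'v) \<Rightarrow> bool" where
  "bihom_lie_coalgebra s L \<Delta> \<alpha> \<beta> \<longleftrightarrow>
     fd_space s L \<and> lin_endo s L \<alpha> \<and> lin_endo s L \<beta> \<and> (\<forall>x\<in>L. \<alpha> (\<beta> x) = \<beta> (\<alpha> x)) \<and>
     lin_map s L fscale (tensor_square s L) \<Delta> \<and>
     (\<forall>x\<in>L. \<Delta> (\<alpha> x) = tmap2 s L \<alpha> \<alpha> (\<Delta> x)) \<and>
     (\<forall>x\<in>L. \<Delta> (\<beta> x) = tmap2 s L \<beta> \<beta> (\<Delta> x)) \<and>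
     (\<forall>x\<in>L. tmap2 s L \<beta> \<alpha> (\<Delta> x) + flip2 (tmap2 s L \<beta> \<alpha> (\<Delta> x)) = 0) \<and>
     (\<forall>x\<in>L. let J = cojac s L \<Delta> \<alpha> \<beta> x in J + flip12 (flip23 J) + flip23 (flip12 J) = 0)"

definition nijenhuis_bihom_lie_coalgebra :: "('k::field \<Rightarrow> 'v::ab_group_add \<Rightarrow> 'v) \<Rightarrow> 'v set \<Rightarrow>
    ('v \<Rightarrow> ('k, 'v) tensor2) \<Rightarrow> ('v \<Rightarrow> 'v) \<Rightarrow> ('v \<Rightarrow> 'v) \<Rightarrow> ('v \<Rightarrow> 'v) \<Rightarrow> bool" where
  "nijenhuis_bihom_lie_coalgebra s L \<Delta> S \<alpha> \<beta> \<longleftrightarrow>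
     bihom_lie_coalgebra s L \<Delta> \<alpha> \<beta> \<and> lin_endo s L S \<and>
     (\<forall>x\<in>L. tmap2 s L S S (\<Delta> x) + \<Delta> (S (S x)) = tmap2 s L S id (\<Delta> (S x)) + tmap2 s L id S (\<Delta> (S x)))"

definition bihom_lie_bialgebra :: "('k::field \<Rightarrow> 'v::ab_group_add \<Rightarrow> 'v) \<Rightarrow> 'v set \<Rightarrow>
    ('v \<Rightarrow> 'v \<Rightarrow> 'v) \<Rightarrow> ('v \<Rightarrow> ('k, 'v) tensor2) \<Rightarrow> ('v \<Rightarrow> 'v) \<Rightarrow> ('v \<Rightarrow> 'v) \<Rightarrow> bool" where
  "bihom_lie_bialgebra s L br \<Delta> \<alpha> \<beta> \<longleftrightarrow>
     bihom_lie_algebra s L br \<alpha> \<beta> \<and> bihom_lie_coalgebra s L \<Delta> \<alpha> \<beta> \<and> bij_betw \<alpha> L L \<and>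
     (let \<alpha>' = inv_into L \<alpha> in \<forall>x\<in>L. \<forall>y\<in>L.
        \<Delta> (br (\<alpha>' (\<beta> x)) y) =
          (tmap2 s L (br (\<beta> x)) \<beta> (\<Delta> y) + tmap2 s L \<beta> (br (\<alpha>' (\<beta> (\<beta> x)))) (\<Delta> y))
          - (tmap2 s L (br (\<beta> y)) \<beta> (\<Delta> x) + tmap2 s L \<beta> (br (\<alpha>' (\<beta> (\<beta> y)))) (\<Delta> x)))"

text \<open>\<open>dual_cobr L \<Delta> a b\<close> is \<open>\<Delta>\<^sup>*(a \<otimes> b)\<close>, the bracket on the dual of \<open>L\<close> induced by \<open>\<Delta>\<close>;
  the pairing of \<open>a \<otimes> b\<close> with a tensor is its value on the bilinear form \<open>(y, z) \<mapsto> a(y) b(z)\<close>.\<close>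

definition dual_cobr :: "'v set \<Rightarrow> ('v \<Rightarrow> ('k::field, 'v) tensor2) \<Rightarrow> ('v \<Rightarrow> 'k) \<Rightarrow> ('v \<Rightarrow> 'k) \<Rightarrow> 'v \<Rightarrow> 'k" where
  "dual_cobr L \<Delta> a b = (\<lambda>x. if x \<in> L then \<Delta> x (\<lambda>y z. a y * b z) else 0)"

definition nijenhuis_bihom_lie_bialgebra :: "('k::field \<Rightarrow> 'v::ab_group_add \<Rightarrow> 'v) \<Rightarrow> 'v set \<Rightarrow>
    ('v \<Rightarrow> 'v \<Rightarrow> 'v) \<Rightarrow> ('v \<Rightarrow> 'v) \<Rightarrow> ('v \<Rightarrow> ('k, 'v) tensor2) \<Rightarrow> ('v \<Rightarrow> 'v) \<Rightarrow> ('v \<Rightarrow> 'v) \<Rightarrow> ('v \<Rightarrow> 'v) \<Rightarrow> bool"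
  where
  "nijenhuis_bihom_lie_bialgebra s L br N \<Delta> S \<alpha> \<beta> \<longleftrightarrow>
     bihom_lie_bialgebra s L br \<Delta> \<alpha> \<beta> \<and>
     involutive_nijenhuis_bihom_lie_algebra s L br N \<alpha> \<beta> \<and>
     nijenhuis_bihom_lie_coalgebra s L \<Delta> S \<alpha> \<beta> \<and>
     adjoint_admissible s L br N \<alpha> \<beta> S \<and>
     adjoint_admissible fscale (dual s L) (dual_cobr L \<Delta>)
       (dual_map L S) (dual_map L \<alpha>) (dual_map L \<beta>) (dual_map L N)"

definition CBHYB :: "('k::field \<Rightarrow> 'v::ab_group_add \<Rightarrow> 'v) \<Rightarrow> 'v set \<Rightarrow>
    ('v \<Rightarrow> 'v \<Rightarrow> 'v) \<Rightarrow> ('v \<Rightarrow> 'v) \<Rightarrow> ('v \<Rightarrow> 'v) \<Rightarrow> ('k, 'v) tensor2 \<Rightarrow> ('k, 'v) tensor3" where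
  "CBHYB s L br \<alpha> \<beta> r = (let \<alpha>' = inv_into L \<alpha> in
     (\<lambda>T. if trilin_form s L T then
        r (\<lambda>r1 r2. r (\<lambda>u1 u2.
            T (br r1 (\<alpha>' (\<beta> u1))) (\<beta> r2) (\<beta> u2)
          + T (\<beta> r1) (br r2 (\<alpha>' (\<beta> u1))) (\<beta> u2)
          + T (\<beta> r1) (\<beta> u1) (br r2 (\<alpha>' (\<beta> u2)))))
      else 0))"

definition solves_S_Nijenhuis_CBHYBE :: "('k::field \<Rightarrow> 'v::ab_group_add \<Rightarrow> 'v) \<Rightarrow> 'v set \<Rightarrow>
    ('v \<Rightarrow> 'v \<Rightarrow> 'v) \<Rightarrow> ('v \<Rightarrow> 'v) \<Rightarrow> ('v \<Rightarrow> 'v) \<Rightarrow> ('v \<Rightarrow> 'v) \<Rightarrow> ('v \<Rightarrow> 'v) \<Rightarrow> ('k, 'v) tensor2 \<Rightarrow> bool" where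
  "solves_S_Nijenhuis_CBHYBE s L br N \<alpha> \<beta> S r \<longleftrightarrow>
     CBHYB s L br \<alpha> \<beta> r = 0 \<and> tmap2 s L S id r - tmap2 s L id N r = 0"

definition cobr_of :: "('k::field \<Rightarrow> 'v::ab_group_add \<Rightarrow> 'v) \<Rightarrow> 'v set \<Rightarrow>
    ('v \<Rightarrow> 'v \<Rightarrow> 'v) \<Rightarrow> ('v \<Rightarrow> 'v) \<Rightarrow> ('v \<Rightarrow> 'v) \<Rightarrow> ('k, 'v) tensor2 \<Rightarrow> 'v \<Rightarrow> ('k, 'v) tensor2" where
  "cobr_of s L br \<alpha> \<beta> r x = tmap2 s L (br x) \<beta> r + tmap2 s L \<beta> (br (inv_into L \<alpha> (\<beta> x))) r"

text \<open>The following lemmas confirm that the operations above act on sums of pure tensors by the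
  usual formulas.\<close>

lemma bilin_form_comp:
  assumes "lin_endo s V f" "lin_endo s V g" "bilin_form s V B"
  shows "bilin_form s V (\<lambda>x y. B (f x) (g y))"
  using assms unfolding bilin_map_def lin_map_def by auto

lemma trilin_form_comp:
  assumes "lin_endo s V f" "lin_endo s V g" "lin_endo s V h" "trilin_form s V T"
  shows "trilin_form s V (\<lambda>x y z. T (f x) (g y) (h z))"
  using assms unfolding trilin_form_def bilin_map_def lin_map_def by auto

lemma tmap2_pure:
  assumes "lin_endo s V f" "lin_endo s V g"
  shows "tmap2 s V f g (pure2 s V x y) = pure2 s V (f x) (g y)"
  by (rule ext) (simp add: tmap2_def pure2_def bilin_form_comp[OF assms])

lemma tmap3_pure:
  assumes "lin_endo s V f" "lin_endo s V g" "lin_endo s V h"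
  shows "tmap3 s V f g h (pure3 s V x y z) = pure3 s V (f x) (g y) (h z)"
  by (rule ext) (simp add: tmap3_def pure3_def trilin_form_comp[OF assms])

lemma flip2_pure: "flip2 (pure2 s V x y) = pure2 s V y x"
proof (rule ext)
  fix B
  have "bilin_form s V (\<lambda>x y. B y x) = bilin_form s V B"
    unfolding bilin_map_def by auto
  then show "flip2 (pure2 s V x y) B = pure2 s V y x B"
    by (simp add: flip2_def pure2_def)
qed

lemma flip12_pure: "flip12 (pure3 s V x y z) = pure3 s V y x z"
proof (rule ext)
  fix T
  have "trilin_form s V (\<lambda>x y z. T y x z) = trilin_form s V T"
    unfolding trilin_form_def bilin_map_def by auto
  then show "flip12 (pure3 s V x y z) T = pure3 s V y x z T"
    by (simp add: flip12_def pure3_def)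
qed

lemma flip23_pure: "flip23 (pure3 s V x y z) = pure3 s V x z y"
proof (rule ext)
  fix T
  have "trilin_form s V (\<lambda>x y z. T x z y) = trilin_form s V T"
    unfolding trilin_form_def bilin_map_def by auto
  then show "flip23 (pure3 s V x y z) T = pure3 s V x z y T"
    by (simp add: flip23_def pure3_def)
qed

lemma sum_fun_apply: "(\<Sum>i\<in>I. f i) x = (\<Sum>i\<in>I. f i x)" for f :: "'i \<Rightarrow> 'a \<Rightarrow> 'b::comm_monoid_add"
  by (induction I rule: infinite_finite_induct) auto

lemma tensor_square_add:
  fixes s :: "'k::field \<Rightarrow> 'v::ab_group_add \<Rightarrow> 'v"
  assumes "t \<in> tensor_square s V" "bilin_form s V B" "bilin_form s V C" "bilin_form s V D"
    and "\<And>x y. x \<in> V \<Longrightarrow> y \<in> V \<Longrightarrow> D x y = B x y + C x y"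
  shows "t D = t B + t C"
proof -
  interpret vector_space "fscale :: 'k \<Rightarrow> ('k, 'v) tensor2 \<Rightarrow> _"
    by unfold_locales (auto simp: fscale_def fun_eq_iff algebra_simps)
  from assms(1)[unfolded tensor_square_def] show ?thesis
  proof (induction rule: span_induct_alt)
    case (step c t u)
    then show ?case using assms(2-) by (auto simp: pure2_def fscale_def algebra_simps)
  qed simp
qed

lemma tensor_square_scale:
  fixes s :: "'k::field \<Rightarrow> 'v::ab_group_add \<Rightarrow> 'v"
  assumes "t \<in> tensor_square s V" "bilin_form s V B" "bilin_form s V D"
    and "\<And>x y. x \<in> V \<Longrightarrow> y \<in> V \<Longrightarrow> D x y = k * B x y"
  shows "t D = k * t B"
proof -
  interpret vector_space "fscale :: 'k \<Rightarrow> ('k, 'v) tensor2 \<Rightarrow> _"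
    by unfold_locales (auto simp: fscale_def fun_eq_iff algebra_simps)
  from assms(1)[unfolded tensor_square_def] show ?thesis
  proof (induction rule: span_induct_alt)
    case (step c t u)
    then show ?case using assms(2-) by (auto simp: pure2_def fscale_def algebra_simps)
  qed simp
qed

lemma tmap_cobr_pure:
  assumes f: "lin_endo s V f" and sub: "vector_space s" "module.subspace s V"
    and x: "x \<in> V" and y: "y \<in> V"
    and \<Delta>: "lin_map s V fscale (tensor_square s V) \<Delta>"
    and \<Delta>y: "\<Delta> y = (\<Sum>i\<in>I. pure2 s V (a i) (b i))"
  shows "tmap_cobr s V f \<Delta> (pure2 s V x y) = (\<Sum>i\<in>I. pure3 s V (f x) (a i) (b i))"
proof (rule ext)
  fix T
  interpret vector_space s by fact
  have B: "bilin_form s V (T (f x))" if "trilin_form s V T" "x \<in> V" for x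
    using that f unfolding trilin_form_def lin_map_def by auto
  have "bilin_form s V (\<lambda>x y. \<Delta> y (T (f x)))" if T: "trilin_form s V T"
    unfolding bilin_map_def
  proof (intro conjI ballI)
    fix x assume x: "x \<in> V"
    show "lin_map s V (*) UNIV (\<lambda>y. \<Delta> y (T (f x)))"
      using \<Delta> unfolding lin_map_def by (auto simp: fscale_def)
  next
    fix y assume "y \<in> V"
    then have t: "\<Delta> y \<in> tensor_square s V" using \<Delta> unfolding lin_map_def by auto
    show "lin_map s V (*) UNIV (\<lambda>x. \<Delta> y (T (f x)))"
      unfolding lin_map_def
    proof (intro conjI ballI allI)
      fix x x' assume xx: "x \<in> V" "x' \<in> V"
      have lin: "lin_map s V (*) UNIV (\<lambda>x. T x u v)" if "u \<in> V" "v \<in> V" for u v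
        using T that unfolding trilin_form_def by auto
      show "\<Delta> y (T (f (x + x'))) = \<Delta> y (T (f x)) + \<Delta> y (T (f x'))"
        using lin f xx
        by (intro tensor_square_add[OF t] B[OF T]) (auto simp: lin_map_def subspace_add[OF sub(2)])
    next
      fix c x assume xx: "x \<in> V"
      have lin: "lin_map s V (*) UNIV (\<lambda>x. T x u v)" if "u \<in> V" "v \<in> V" for u v
        using T that unfolding trilin_form_def by auto
      show "\<Delta> y (T (f (s c x))) = c * \<Delta> y (T (f x))"
        using lin f xx
        by (intro tensor_square_scale[OF t] B[OF T]) (auto simp: lin_map_def subspace_scale[OF sub(2)])
    qed auto
  qed
  then show "tmap_cobr s V f \<Delta> (pure2 s V x y) T = (\<Sum>i\<in>I. pure3 s V (f x) (a i) (b i)) T"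
    using B[OF _ x] by (auto simp: tmap_cobr_def pure2_def pure3_def \<Delta>y sum_fun_apply)
qed

lemma bilin_form_sum:
  assumes "\<And>i. i \<in> I \<Longrightarrow> bilin_form s V (B i)"
  shows "bilin_form s V (\<lambda>x y. \<Sum>i\<in>I. B i x y)"
  using assms by (auto simp: bilin_map_def lin_map_def sum.distrib sum_distrib_left)

lemma CBHYB_sum:
  assumes br: "bilin_map s V s V s V br" and \<alpha>: "lin_endo s V \<alpha>" "bij_betw \<alpha> V V"
    and \<beta>: "lin_endo s V \<beta>" and sub: "vector_space s" "module.subspace s V"
    and xy: "\<And>i. i \<in> I \<Longrightarrow> x i \<in> V" "\<And>i. i \<in> I \<Longrightarrow> y i \<in> V"
  defines "\<gamma> \<equiv> \<lambda>z. inv_into V \<alpha> (\<beta> z)"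
  shows "CBHYB s V br \<alpha> \<beta> (\<Sum>i\<in>I. pure2 s V (x i) (y i)) =
    (\<Sum>i\<in>I. \<Sum>j\<in>I. pure3 s V (br (x i) (\<gamma> (x j))) (\<beta> (y i)) (\<beta> (y j))
       + pure3 s V (\<beta> (x i)) (br (y i) (\<gamma> (x j))) (\<beta> (y j))
       + pure3 s V (\<beta> (x i)) (\<beta> (x j)) (br (y i) (\<gamma> (y j))))"
    (is "?lhs = ?rhs")
proof (rule ext)
  fix T
  interpret vector_space s by fact
  have inv: "inv_into V \<alpha> z \<in> V" "\<alpha> (inv_into V \<alpha> z) = z" if "z \<in> V" for z
    using \<alpha>(2) that by (auto simp: bij_betw_def intro!: inv_into_into f_inv_into_f)
  have inj: "u = v" if "u \<in> V" "v \<in> V" "\<alpha> u = \<alpha> v" for u v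
    using \<alpha>(2) that by (auto simp: bij_betw_def inj_on_def)
  have V: "\<And>u v. u \<in> V \<Longrightarrow> v \<in> V \<Longrightarrow> u + v \<in> V" "\<And>u c. u \<in> V \<Longrightarrow> s c u \<in> V"
    using sub(2) subspace_add subspace_scale by auto
  have \<beta>V: "\<And>u. u \<in> V \<Longrightarrow> \<beta> u \<in> V" "\<And>u v. u \<in> V \<Longrightarrow> v \<in> V \<Longrightarrow> \<beta> (u + v) = \<beta> u + \<beta> v"
    "\<And>u c. u \<in> V \<Longrightarrow> \<beta> (s c u) = s c (\<beta> u)"
    using \<beta> by (auto simp: lin_map_def)
  have \<alpha>V: "\<And>u v. u \<in> V \<Longrightarrow> v \<in> V \<Longrightarrow> \<alpha> (u + v) = \<alpha> u + \<alpha> v"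
    "\<And>u c. u \<in> V \<Longrightarrow> \<alpha> (s c u) = s c (\<alpha> u)"
    using \<alpha>(1) by (auto simp: lin_map_def)
  have \<gamma>V: "\<gamma> u \<in> V" if "u \<in> V" for u using inv(1) \<beta>V(1) that by (simp add: \<gamma>_def)
  have \<gamma>a: "\<gamma> (u + v) = \<gamma> u + \<gamma> v" if "u \<in> V" "v \<in> V" for u v
    unfolding \<gamma>_def using that by - (rule inj, simp_all add: \<alpha>V V inv \<beta>V)
  have \<gamma>s: "\<gamma> (s c u) = s c (\<gamma> u)" if "u \<in> V" for u c
    unfolding \<gamma>_def using that by - (rule inj, simp_all add: \<alpha>V V inv \<beta>V)
  have brV: "\<And>u v. u \<in> V \<Longrightarrow> v \<in> V \<Longrightarrow> br u v \<in> V"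
    "\<And>u v w. u \<in> V \<Longrightarrow> v \<in> V \<Longrightarrow> w \<in> V \<Longrightarrow> br (u + w) v = br u v + br w v"
    "\<And>u v w. u \<in> V \<Longrightarrow> v \<in> V \<Longrightarrow> w \<in> V \<Longrightarrow> br u (v + w) = br u v + br u w"
    "\<And>u v c. u \<in> V \<Longrightarrow> v \<in> V \<Longrightarrow> br (s c u) v = s c (br u v)"
    "\<And>u v c. u \<in> V \<Longrightarrow> v \<in> V \<Longrightarrow> br u (s c v) = s c (br u v)"
    using br by (auto simp: bilin_map_def lin_map_def)
  note V' = V \<beta>V \<gamma>V \<gamma>a \<gamma>s brV
  let ?F = "\<lambda>T r1 r2 u1 u2. T (br r1 (\<gamma> u1)) (\<beta> r2) (\<beta> u2)
          + T (\<beta> r1) (br r2 (\<gamma> u1)) (\<beta> u2) + T (\<beta> r1) (\<beta> u1) (br r2 (\<gamma> u2))"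
  show "?lhs T = ?rhs T"
  proof (cases "trilin_form s V T")
    case True
    have Ta: "T (u + u') v w = T u v w + T u' v w" "T v (u + u') w = T v u w + T v u' w"
      "T v w (u + u') = T v w u + T v w u'" if "u \<in> V" "u' \<in> V" "v \<in> V" "w \<in> V" for u u' v w
      using True that by (auto simp: trilin_form_def bilin_map_def lin_map_def)
    have Ts: "T (s c u) v w = c * T u v w" "T v (s c u) w = c * T v u w"
      "T v w (s c u) = c * T v w u" if "u \<in> V" "v \<in> V" "w \<in> V" for c u v w
      using True that by (auto simp: trilin_form_def bilin_map_def lin_map_def)
    have 1: "bilin_form s V (?F T r1 r2)" if "r1 \<in> V" "r2 \<in> V" for r1 r2
      using that by (auto simp: bilin_map_def lin_map_def V' Ta Ts algebra_simps)
    have 2: "bilin_form s V (\<lambda>r1 r2. ?F T r1 r2 u1 u2)" if "u1 \<in> V" "u2 \<in> V" for u1 u2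
      using that by (auto simp: bilin_map_def lin_map_def V' Ta Ts algebra_simps)
    let ?r = "\<Sum>i\<in>I. pure2 s V (x i) (y i)"
    have r: "?r B = (\<Sum>i\<in>I. B (x i) (y i))" if "bilin_form s V B" for B
      using that by (simp add: sum_fun_apply pure2_def)
    have r1: "?r (?F T r1 r2) = (\<Sum>j\<in>I. ?F T r1 r2 (x j) (y j))" if "r1 \<in> V" "r2 \<in> V" for r1 r2
      by (rule r[OF 1[OF that]])
    have 3: "bilin_form s V (\<lambda>r1 r2. \<Sum>j\<in>I. ?F T r1 r2 (x j) (y j))"
      by (rule bilin_form_sum) (rule 2, auto simp: xy)
    have "bilin_form s V (\<lambda>r1 r2. ?r (?F T r1 r2))"
      using 3 r1 V unfolding bilin_map_def lin_map_def by simp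
    from r[OF this] have "?r (\<lambda>r1 r2. ?r (?F T r1 r2)) = (\<Sum>i\<in>I. \<Sum>j\<in>I. ?F T (x i) (y i) (x j) (y j))"
      using xy r1 by simp
    moreover have "?lhs T = ?r (\<lambda>r1 r2. ?r (?F T r1 r2))"
      using True by (simp add: CBHYB_def Let_def \<gamma>_def)
    ultimately show ?thesis
      using True by (simp add: sum_fun_apply pure3_def)
  qed (simp add: CBHYB_def sum_fun_apply pure3_def Let_def)
qed

end

theory Submission
  imports Defs
begin

text \<open>
  The proof removes the BiHom twist, proves the result for Lie algebras, and twists back.

  Since \<open>\<alpha>\<close> and \<open>\<beta>\<close> are commuting involutions, \<open>lie x y = [\<alpha> x, \<beta> y]\<close> is a Lie bracket (antisymmetric, with
  the Jacobi identity) with automorphisms \<open>\<alpha>\<close>, \<open>\<beta>\<close>, and the Nijenhuis and admissibility identities keep their form for it, because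
  \<open>N\<close> and \<open>S\<close> commute with \<open>\<alpha>\<close> and \<open>\<beta>\<close>.  The tensor \<open>r' = (\<alpha>\<beta> \<otimes> id) r\<close> is skew, invariant under \<open>\<alpha>\<close> and
  \<open>\<beta>\<close>, satisfies \<open>(S \<otimes> id) r' = (id \<otimes> N) r'\<close> and solves the classical Yang-Baxter equation for \<open>lie\<close>.
  With \<open>\<delta>(x) = x \<cdot> r'\<close> its coboundary, \<open>\<Delta>\<^sub>r = (\<alpha> \<otimes> \<beta>) \<delta>\<close>.

  For \<open>\<delta>\<close> the statements are classical in style.  Cocycle identity and skewness are immediate; the co-Jacobi
  identity holds because the cyclic sum of \<open>(id \<otimes> \<delta>) \<delta>(x)\<close> is \<open>x \<cdot> CYB(r')\<close> (\<open>cob_cojacobi\<close>).  The two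
  identities involving \<open>S\<close> and \<open>N\<close> on the coalgebra side (\<open>cob_conijenhuis\<close>, \<open>cob_coadmissible\<close>) follow by
  moving \<open>S\<close> and \<open>N\<close> between the factors of \<open>r'\<close>, after which admissibility of \<open>S\<close> and the Nijenhuis identity of
  \<open>N\<close> finish each tensor factor separately.

  The conditions on the dual need two general facts.  The dual of a BiHom-Lie coalgebra is a BiHom-Lie algebra,
  by evaluating tensors on products of functionals (\<open>dual_bihom_lie_algebra\<close>); and over an involutive
  Nijenhuis BiHom-Lie algebra adjoint-admissibility reduces to a single identity besides commutation with the structure maps, because the
  coadjoint action is automatically a representation (\<open>adjoint_admissible_iff\<close>).

  Tensors are handled through their values on bilinear forms, so every identity between tensors becomes an
  identity between finite sums of scalars.
\<close>

section \<open>Tensors and duals\<close>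

lemma vector_space_fscale: "vector_space (fscale :: 'k::field \<Rightarrow> ('a \<Rightarrow> 'k) \<Rightarrow> 'a \<Rightarrow> 'k)"
  by unfold_locales (auto simp: fscale_def fun_eq_iff algebra_simps)

lemma linD:
  assumes "lin_map s V t W f"
  shows lin_closed: "\<And>x. x \<in> V \<Longrightarrow> f x \<in> W"
    and lin_add: "\<And>x y. x \<in> V \<Longrightarrow> y \<in> V \<Longrightarrow> f (x + y) = f x + f y"
    and lin_scale: "\<And>c x. x \<in> V \<Longrightarrow> f (s c x) = t c (f x)"
  using assms by (auto simp: lin_map_def)

lemma bilinD:
  assumes "bilin_map s V t W u U f"
  shows bilin_closed: "\<And>x y. x \<in> V \<Longrightarrow> y \<in> W \<Longrightarrow> f x y \<in> U"
    and bilin_add_left: "\<And>x x' y. x \<in> V \<Longrightarrow> x' \<in> V \<Longrightarrow> y \<in> W \<Longrightarrow> f (x + x') y = f x y + f x' y"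
    and bilin_add_right: "\<And>x y y'. x \<in> V \<Longrightarrow> y \<in> W \<Longrightarrow> y' \<in> W \<Longrightarrow> f x (y + y') = f x y + f x y'"
    and bilin_scale_left: "\<And>c x y. x \<in> V \<Longrightarrow> y \<in> W \<Longrightarrow> f (s c x) y = u c (f x y)"
    and bilin_scale_right: "\<And>c x y. x \<in> V \<Longrightarrow> y \<in> W \<Longrightarrow> f x (t c y) = u c (f x y)"
  using assms by (auto simp: bilin_map_def lin_map_def)

lemma trilinD:
  assumes "trilin_form s V T" "x \<in> V" "y \<in> V" "z \<in> V"
  shows trilin_add1: "\<And>x'. x' \<in> V \<Longrightarrow> T (x + x') y z = T x y z + T x' y z"
    and trilin_add2: "\<And>y'. y' \<in> V \<Longrightarrow> T x (y + y') z = T x y z + T x y' z"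
    and trilin_add3: "\<And>z'. z' \<in> V \<Longrightarrow> T x y (z + z') = T x y z + T x y z'"
    and trilin_scale1: "\<And>c. T (s c x) y z = c * T x y z"
    and trilin_scale2: "\<And>c. T x (s c y) z = c * T x y z"
    and trilin_scale3: "\<And>c. T x y (s c z) = c * T x y z"
  using assms by (auto simp: trilin_form_def bilin_map_def lin_map_def)

lemma bilin_form_swap: "bilin_form s V (\<lambda>x y. B y x) = bilin_form s V B"
  unfolding bilin_map_def by auto

locale carrier_space =
  fixes s :: "'k::field \<Rightarrow> 'v::ab_group_add \<Rightarrow> 'v" and V :: "'v set"
  assumes vs: "vector_space s" and sub: "module.subspace s V"
begin

sublocale VS: vector_space s by (rule vs)

lemma carrier_closed [simp]:
  "0 \<in> V" "x \<in> V \<Longrightarrow> y \<in> V \<Longrightarrow> x + y \<in> V" "x \<in> V \<Longrightarrow> s c x \<in> V"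
  "x \<in> V \<Longrightarrow> - x \<in> V" "x \<in> V \<Longrightarrow> y \<in> V \<Longrightarrow> x - y \<in> V"
  using sub VS.subspace_0 VS.subspace_add VS.subspace_scale VS.subspace_neg VS.subspace_diff
  by auto

lemma lin_neg:
  assumes "lin_map s V t W f" "vector_space t" "x \<in> V"
  shows "f (- x) = - f x"
proof -
  interpret T: vector_space t by fact
  have "f (s (-1) x) = t (-1) (f x)" by (rule lin_scale[OF assms(1,3)])
  then show ?thesis by simp
qed

lemma vector_space_times: "vector_space ((*) :: 'k \<Rightarrow> 'k \<Rightarrow> 'k)"
  by unfold_locales (auto simp: algebra_simps)

lemma bilin_form_neg:
  assumes "bilin_form s V T" "x \<in> V" "y \<in> V"
  shows "T (- x) y = - T x y" "T x (- y) = - T x y"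
  using lin_neg[OF _ vector_space_times assms(2), of UNIV "\<lambda>x. T x y"]
    lin_neg[OF _ vector_space_times assms(3), of UNIV "T x"] assms
  by (simp_all add: bilin_map_def)

lemma trilin_form_neg:
  assumes "trilin_form s V T" "x \<in> V" "y \<in> V" "z \<in> V"
  shows "T (- x) y z = - T x y z" "T x (- y) z = - T x y z" "T x y (- z) = - T x y z"
  using lin_neg[OF _ vector_space_times assms(2), of UNIV "\<lambda>x. T x y z"]
    bilin_form_neg[of "T x" y z] assms
  by (simp_all add: trilin_form_def)

text \<open>Bilinearity refers to \<open>V\<close> only, so a tensor cannot see the values of a form off the carrier.\<close>

lemma bilin_form_cong:
  assumes "\<And>x y. x \<in> V \<Longrightarrow> y \<in> V \<Longrightarrow> B x y = C x y"
  shows "bilin_form s V B = bilin_form s V C"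
  unfolding bilin_map_def lin_map_def using assms by simp

lemma pure2_in: "x \<in> V \<Longrightarrow> y \<in> V \<Longrightarrow> pure2 s V x y \<in> tensor_square s V"
  unfolding tensor_square_def
  by (rule module.span_base[OF module_iff_vector_space[THEN iffD2, OF vector_space_fscale]]) auto

lemma subspace_tensor_square: "module.subspace fscale (tensor_square s V)"
  unfolding tensor_square_def
  by (intro module.subspace_span module_iff_vector_space[THEN iffD2] vector_space_fscale)

sublocale TS: vector_space "fscale :: 'k \<Rightarrow> ('k, 'v) tensor2 \<Rightarrow> ('k, 'v) tensor2"
  by (rule vector_space_fscale)

text \<open>
  This turns Sweedler notation into honest finite sums: a scalar coefficient of a pure tensor is moved
  into its first factor.  The families are total functions with all values in \<open>V\<close>, so that no
  membership conditions on the index appear later.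
\<close>

lemma tensor_square_as_sum:
  assumes "t \<in> tensor_square s V"
  obtains n :: nat and x y where "\<And>i. x i \<in> V" "\<And>i. y i \<in> V"
    "t = (\<Sum>i<n. pure2 s V (x i) (y i))"
proof -
  have "\<exists>(n::nat) x y. (\<forall>i. x i \<in> V) \<and> (\<forall>i. y i \<in> V) \<and> t = (\<Sum>i<n. pure2 s V (x i) (y i))"
    using assms unfolding tensor_square_def
  proof (induction rule: TS.span_induct_alt)
    case base
    show ?case by (rule exI[of _ 0]) (auto intro!: exI[of _ "\<lambda>_. 0"])
  next
    case (step c u t)
    from step(1) obtain a b where u: "u = pure2 s V a b" "a \<in> V" "b \<in> V" by auto
    from step(2) obtain n x y where
      t: "\<And>i::nat. x i \<in> V" "\<And>i. y i \<in> V" "t = (\<Sum>i<n. pure2 s V (x i) (y i))" by auto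
    have "fscale c u = pure2 s V (s c a) b"
      using u by (auto simp: fscale_def pure2_def fun_eq_iff bilin_scale_left)
    then have "fscale c u + t = (\<Sum>i<Suc n. pure2 s V ((x(n := s c a)) i) ((y(n := b)) i))"
      by (simp add: t(3) add.commute)
    moreover have "(x(n := s c a)) i \<in> V" "(y(n := b)) i \<in> V" for i using t u by auto
    ultimately show ?case by blast
  qed
  then show ?thesis using that by blast
qed

lemma sum_pure2_eval:
  "(\<Sum>i\<in>I. pure2 s V (x i) (y i)) B = (if bilin_form s V B then \<Sum>i\<in>I. B (x i) (y i) else 0)"
  by (simp add: sum_fun_apply pure2_def)

lemma tensor_cong:
  assumes "t \<in> tensor_square s V" "\<And>x y. x \<in> V \<Longrightarrow> y \<in> V \<Longrightarrow> B x y = C x y"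
  shows "t B = t C"
  using assms(1) bilin_form_cong[OF assms(2)] assms(2)
  by (elim tensor_square_as_sum) (simp add: sum_pure2_eval)

lemma tensor_not_bilin:
  assumes "t \<in> tensor_square s V" "\<not> bilin_form s V B"
  shows "t B = 0"
  using assms by (elim tensor_square_as_sum) (simp add: sum_pure2_eval)

lemma tmap2_in:
  assumes "t \<in> tensor_square s V" and fg: "lin_endo s V f" "lin_endo s V g"
  shows "tmap2 s V f g t \<in> tensor_square s V"
proof -
  obtain n :: nat and x y where xy: "\<And>i. x i \<in> V" "\<And>i. y i \<in> V"
    and t: "t = (\<Sum>i<n. pure2 s V (x i) (y i))" using tensor_square_as_sum[OF assms(1)] by blast
  have "tmap2 s V f g t = (\<Sum>i<n. pure2 s V (f (x i)) (g (y i)))"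
    unfolding t by (rule ext) (simp add: tmap2_def sum_pure2_eval bilin_form_comp[OF fg])
  also have "\<dots> \<in> tensor_square s V"
    by (intro TS.subspace_sum subspace_tensor_square pure2_in lin_closed[OF fg(1)] lin_closed[OF fg(2)] xy)
  finally show ?thesis .
qed

lemma carrier_space_dual: "carrier_space fscale (dual s V)"
proof (rule carrier_space.intro)
  show "vector_space (fscale :: 'k \<Rightarrow> ('v \<Rightarrow> 'k) \<Rightarrow> _)" by (rule vector_space_fscale)
  interpret F: vector_space "fscale :: 'k \<Rightarrow> ('v \<Rightarrow> 'k) \<Rightarrow> _" by (rule vector_space_fscale)
  show "module.subspace fscale (dual s V)"
    by (rule F.subspaceI) (auto simp: dual_def lin_map_def fscale_def algebra_simps)
qed

end

lemma carrier_space_of_fd: "fd_space s V \<Longrightarrow> carrier_space s V"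
  by (simp add: fd_space_def carrier_space_def)

lemma dualI:
  assumes "lin_map s V (*) UNIV f" "\<And>x. x \<in> V \<Longrightarrow> a x = f x" "\<And>x. x \<notin> V \<Longrightarrow> a x = 0"
    "carrier_space s V"
  shows "a \<in> dual s V"
proof -
  interpret carrier_space s V by fact
  show ?thesis using assms(1-3) by (auto simp: dual_def lin_map_def)
qed

text \<open>
  The functionals \<open>e b\<close> are the coordinates with respect to a basis \<open>B\<close>; they give both separation of
  points and a finite spanning set of the dual.
\<close>

lemma fd_coordinates:
  fixes s :: "'k::field \<Rightarrow> 'v::ab_group_add \<Rightarrow> 'v"
  assumes "fd_space s V"
  obtains B e where "finite B" "B \<subseteq> V" "\<And>b. e b \<in> dual s V"
    "\<And>x. x \<in> V \<Longrightarrow> x = (\<Sum>b\<in>B. s (e b x) b)"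
proof -
  interpret carrier_space s V using assms by (rule carrier_space_of_fd)
  obtain A where A: "finite A" "VS.span A = V" using assms by (auto simp: fd_space_def)
  obtain B where B: "B \<subseteq> A" "VS.independent B" "VS.span B = V"
    using VS.maximal_independent_subset[of A] VS.span_mono[of _ A] VS.span_subspace A(2)
    by (metis VS.span_superset VS.span_minimal VS.subspace_span subset_antisym)
  have fin: "finite B" using A(1) B(1) finite_subset by blast
  define e where "e b x = (if x \<in> V then VS.representation B x b else 0)" for b x
  have "e b \<in> dual s V" for b
    using B(2,3) by (auto simp: dual_def lin_map_def e_def VS.representation_add VS.representation_scale)
  moreover have "x = (\<Sum>b\<in>B. s (e b x) b)" if "x \<in> V" for x
    using VS.sum_representation_eq[OF B(2) _ fin subset_refl, of x] that B(3) by (simp add: e_def)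
  moreover have "B \<subseteq> V" using B(3) VS.span_superset by blast
  ultimately show ?thesis using fin that by blast
qed

text \<open>
  Needed because admissibility says that \<open>S\<^sup>*\<close> commutes with \<open>\<alpha>\<^sup>*\<close> and \<open>\<beta>\<^sup>*\<close> on the dual, whereas the proof uses
  that \<open>S\<close> commutes with \<open>\<alpha>\<close> and \<open>\<beta>\<close> on the space itself.
\<close>

lemma dual_separates:
  assumes "fd_space s V" "x \<in> V" "y \<in> V" "\<And>a. a \<in> dual s V \<Longrightarrow> a x = a y"
  shows "x = y"
proof -
  obtain B e where e: "\<And>b. e b \<in> dual s V"
    and rep: "\<And>x. x \<in> V \<Longrightarrow> x = (\<Sum>b\<in>B. s (e b x) b)"
    using fd_coordinates[OF assms(1)] by metis
  have "x = (\<Sum>b\<in>B. s (e b x) b)" by (rule rep[OF assms(2)])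
  also have "\<dots> = (\<Sum>b\<in>B. s (e b y) b)" using assms(4)[OF e] by simp
  also have "\<dots> = y" by (rule rep[OF assms(3), symmetric])
  finally show ?thesis .
qed

lemma fd_space_dual:
  fixes s :: "'k::field \<Rightarrow> 'v::ab_group_add \<Rightarrow> 'v"
  assumes "fd_space s V"
  shows "fd_space fscale (dual s V)"
proof -
  interpret carrier_space s V using assms by (rule carrier_space_of_fd)
  interpret D: carrier_space "fscale :: 'k \<Rightarrow> ('v \<Rightarrow> 'k) \<Rightarrow> _" "dual s V" by (rule carrier_space_dual)
  obtain B e where B: "finite B" "B \<subseteq> V" and e: "\<And>b. e b \<in> dual s V"
    and rep: "\<And>x. x \<in> V \<Longrightarrow> x = (\<Sum>b\<in>B. s (e b x) b)"
    using fd_coordinates[OF assms] by metis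
  have lin_sum: "a (\<Sum>b\<in>C. f b) = (\<Sum>b\<in>C. a (f b))" 
    if "a \<in> dual s V" "finite C" "\<And>b. b \<in> C \<Longrightarrow> f b \<in> V" for a f and C :: "'v set"
    using that(2,3)
  proof (induction rule: finite_induct)
    case empty
    have "a 0 + a 0 = a 0 + 0" using that(1) lin_add[of s V "(*)" UNIV a 0 0] by (simp add: dual_def)
    then show ?case by (simp only: add_left_cancel sum.empty)
  next
    case (insert b C)
    have "a (f b + sum f C) = a (f b) + a (sum f C)"
      using that(1) insert by (intro lin_add[of s V "(*)" UNIV a]) (auto simp: dual_def intro: VS.subspace_sum[OF sub])
    then show ?case using insert by simp
  qed
  have "a = (\<Sum>b\<in>B. fscale (a b) (e b))" if a: "a \<in> dual s V" for a
  proof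
    fix x show "a x = (\<Sum>b\<in>B. fscale (a b) (e b)) x"
    proof (cases "x \<in> V")
      case True
      have "a x = a (\<Sum>b\<in>B. s (e b x) b)" using rep[OF True] by simp
      also have "\<dots> = (\<Sum>b\<in>B. a (s (e b x) b))" using B by (intro lin_sum a) auto
      also have "\<dots> = (\<Sum>b\<in>B. e b x * a b)"
        using B a by (intro sum.cong refl lin_scale[of s V "(*)" UNIV a]) (auto simp: dual_def)
      finally show ?thesis by (simp add: sum_fun_apply fscale_def mult.commute)
    next
      case False
      then show ?thesis using a e by (simp add: sum_fun_apply fscale_def dual_def)
    qed
  qed
  moreover have "(\<Sum>b\<in>B. fscale (a b) (e b)) \<in> D.VS.span (e ` B)" for a
    by (intro D.VS.span_sum D.VS.span_scale D.VS.span_base imageI)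
  ultimately have "dual s V \<subseteq> D.VS.span (e ` B)" by (metis (no_types, lifting) subsetI)
  moreover have "D.VS.span (e ` B) \<subseteq> dual s V"
    by (rule D.VS.span_minimal[OF _ D.sub]) (use e in auto)
  ultimately have "D.VS.span (e ` B) = dual s V" by (rule subset_antisym[rotated])
  with B(1) show ?thesis
    unfolding fd_space_def by (intro conjI D.vs D.sub exI[of _ "e ` B"]) auto
qed

section \<open>Untwisting and the coadjoint representation\<close>

context carrier_space begin

lemma bilin_op_neg:
  assumes "bilin_map s V s V s V f" "x \<in> V" "y \<in> V"
  shows "f (- x) y = - f x y" "f x (- y) = - f x y"
  using lin_neg[OF _ vs, of V "\<lambda>x. f x y" x] lin_neg[OF _ vs, of V "f x" y] assms
  by (auto simp: bilin_map_def)

end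

text \<open>
  Antisymmetry is demanded instead of \<open>lb x x = 0\<close>, as this is what untwisting a BiHom-Lie bracket gives;
  the two differ in characteristic 2 only.
\<close>

locale carrier_lie_algebra = carrier_space s L
  for s :: "'k::field \<Rightarrow> 'v::ab_group_add \<Rightarrow> 'v" and L :: "'v set" +
  fixes lb :: "'v \<Rightarrow> 'v \<Rightarrow> 'v"
  assumes lb_bilin: "bilin_map s L s L s L lb"
    and lb_skew: "x \<in> L \<Longrightarrow> y \<in> L \<Longrightarrow> lb x y = - lb y x"
    and lb_leibniz: "x \<in> L \<Longrightarrow> y \<in> L \<Longrightarrow> z \<in> L \<Longrightarrow> lb x (lb y z) = lb (lb x y) z + lb y (lb x z)"
begin

lemmas lb_simps [simp] = bilin_closed[OF lb_bilin] bilin_add_left[OF lb_bilin]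
  bilin_add_right[OF lb_bilin] bilin_scale_left[OF lb_bilin] bilin_scale_right[OF lb_bilin]
  bilin_op_neg[OF lb_bilin]

end

locale involutive_bihom_lie =
  fixes s :: "'k::field \<Rightarrow> 'v::ab_group_add \<Rightarrow> 'v" and L :: "'v set"
    and br :: "'v \<Rightarrow> 'v \<Rightarrow> 'v" and \<alpha> \<beta> :: "'v \<Rightarrow> 'v"
  assumes alg: "bihom_lie_algebra s L br \<alpha> \<beta>"
    and \<alpha>\<alpha> [simp]: "x \<in> L \<Longrightarrow> \<alpha> (\<alpha> x) = x"
    and \<beta>\<beta> [simp]: "x \<in> L \<Longrightarrow> \<beta> (\<beta> x) = x"
begin

lemma fd: "fd_space s L" using alg by (simp add: bihom_lie_algebra_def)

sublocale carrier_space s L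
  by (rule carrier_space_of_fd[OF fd])

lemma \<alpha>_lin: "lin_endo s L \<alpha>" and \<beta>_lin: "lin_endo s L \<beta>" and br_bilin: "bilin_map s L s L s L br"
  using alg unfolding bihom_lie_algebra_def by blast+

lemmas \<alpha>_simps [simp] = linD[OF \<alpha>_lin] lin_neg[OF \<alpha>_lin vs]
lemmas \<beta>_simps [simp] = linD[OF \<beta>_lin] lin_neg[OF \<beta>_lin vs]
lemmas br_simps [simp] = bilinD[OF br_bilin]

lemma \<alpha>\<beta> [simp]: "x \<in> L \<Longrightarrow> \<alpha> (\<beta> x) = \<beta> (\<alpha> x)"
  and \<alpha>_br: "x \<in> L \<Longrightarrow> y \<in> L \<Longrightarrow> \<alpha> (br x y) = br (\<alpha> x) (\<alpha> y)"
  and \<beta>_br: "x \<in> L \<Longrightarrow> y \<in> L \<Longrightarrow> \<beta> (br x y) = br (\<beta> x) (\<beta> y)"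
  and br_skew: "x \<in> L \<Longrightarrow> y \<in> L \<Longrightarrow> br (\<beta> x) (\<alpha> y) = - br (\<beta> y) (\<alpha> x)"
  and br_jacobi: "x \<in> L \<Longrightarrow> y \<in> L \<Longrightarrow> z \<in> L \<Longrightarrow>
        br (\<beta> (\<beta> x)) (br (\<beta> y) (\<alpha> z)) + br (\<beta> (\<beta> y)) (br (\<beta> z) (\<alpha> x))
        + br (\<beta> (\<beta> z)) (br (\<beta> x) (\<alpha> y)) = 0"
  using alg unfolding bihom_lie_algebra_def by blast+

text \<open>
  Yau's twisting, undone: on an involutive BiHom-Lie algebra \<open>\<alpha>\<close> and \<open>\<beta>\<close> are their own inverses, so
  precomposing the bracket with \<open>\<alpha> \<otimes> \<beta>\<close> removes the twist.  The result is an ordinary Lie bracket of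
  which \<open>\<alpha>\<close> and \<open>\<beta>\<close> are automorphisms, and \<open>[x,y] = lie (\<alpha> x) (\<beta> y)\<close>.
\<close>

definition lie :: "'v \<Rightarrow> 'v \<Rightarrow> 'v" where "lie x y = br (\<alpha> x) (\<beta> y)"

lemma br_eq_lie: "x \<in> L \<Longrightarrow> y \<in> L \<Longrightarrow> br x y = lie (\<alpha> x) (\<beta> y)"
  by (simp add: lie_def)

lemma \<alpha>_lie: "x \<in> L \<Longrightarrow> y \<in> L \<Longrightarrow> \<alpha> (lie x y) = lie (\<alpha> x) (\<alpha> y)"
  and \<beta>_lie: "x \<in> L \<Longrightarrow> y \<in> L \<Longrightarrow> \<beta> (lie x y) = lie (\<beta> x) (\<beta> y)"
  by (simp_all add: lie_def \<alpha>_br \<beta>_br)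

lemma lie_bilin: "bilin_map s L s L s L lie"
  by (simp add: bilin_map_def lin_map_def lie_def)

lemma lie_skew: assumes "x \<in> L" "y \<in> L" shows "lie x y = - lie y x"
  using br_skew[of "\<beta> (\<alpha> x)" "\<beta> (\<alpha> y)"] assms by (simp add: lie_def)

sublocale lie: carrier_lie_algebra s L lie
proof (unfold_locales, rule lie_bilin, erule (1) lie_skew)
  fix x y z assume xyz: "x \<in> L" "y \<in> L" "z \<in> L"
  note lie_closed = bilin_closed[OF lie_bilin]
  have "lie x (lie y z) + lie y (lie z x) + lie z (lie x y) = 0"
    using br_jacobi[of "\<alpha> x" "\<alpha> y" "\<alpha> z"] xyz
    by (simp add: br_eq_lie \<beta>_lie lie_closed)
  moreover have "lie z (lie x y) = - lie (lie x y) z"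
    using xyz lie_skew[of z "lie x y"] lie_closed by simp
  moreover have "lie y (lie z x) = - lie y (lie x z)"
    using xyz lie_skew[of z x] lie_closed bilin_op_neg[OF lie_bilin] by simp
  ultimately show "lie x (lie y z) = lie (lie x y) z + lie y (lie x z)"
    by (simp add: algebra_simps add_eq_0_iff)
qed

text \<open>
  Untwisted, this is the Leibniz rule for \<open>x\<close>, \<open>\<alpha> y\<close>, \<open>z\<close>; paired with a functional on \<open>L\<close> it is exactly the
  representation axiom of the coadjoint action.
\<close>

lemma br_module_identity:
  assumes "x \<in> L" "y \<in> L" "z \<in> L"
  shows "\<beta> (br (br (\<beta> x) y) z) = br (\<alpha> x) (br (\<beta> y) z) - br y (br (\<alpha> (\<beta> x)) z)"
  using assms by (simp add: br_eq_lie \<alpha>_lie \<beta>_lie lie.lb_leibniz[of x "\<alpha> y" z])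

lemma bij_\<alpha>: "bij_betw \<alpha> L L"
  by (rule bij_betw_byWitness[where f' = \<alpha>]) auto

lemma inv_\<alpha> [simp]: "x \<in> L \<Longrightarrow> inv_into L \<alpha> x = \<alpha> x"
  using bij_\<alpha> by (metis \<alpha>\<alpha> \<alpha>_simps(1) bij_betw_inv_into_left)

end

lemma dual_map_in:
  assumes "lin_endo s V f" "carrier_space s V" "a \<in> dual s V"
  shows "dual_map V f a \<in> dual s V"
  by (rule dualI[of _ _ "\<lambda>x. a (f x)"])
    (use assms in \<open>auto simp: dual_map_def dual_def lin_map_def\<close>)

lemma lin_dual_map:
  assumes "lin_endo s V f" "carrier_space s V"
  shows "lin_endo fscale (dual s V) (dual_map V f)"
  using dual_map_in[OF assms] by (auto simp: lin_map_def dual_map_def fscale_def fun_eq_iff)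

lemma dual_map_commute:
  assumes "\<And>x. x \<in> V \<Longrightarrow> f x \<in> V" "\<And>x. x \<in> V \<Longrightarrow> g x \<in> V" "\<And>x. x \<in> V \<Longrightarrow> f (g x) = g (f x)"
  shows "dual_map V f (dual_map V g a) = dual_map V g (dual_map V f a)"
  using assms by (auto simp: dual_map_def fun_eq_iff)

lemma (in involutive_bihom_lie) coadjoint_representation:
  "bihom_representation s L br \<alpha> \<beta> fscale (dual s L) (coad L br) (dual_map L \<alpha>) (dual_map L \<beta>)"
proof -
  have in_dual: "coad L br x a \<in> dual s L" if "x \<in> L" "a \<in> dual s L" for x a
    by (rule dualI[of _ _ "\<lambda>y. - a (br x y)"])
      (use that carrier_space_axioms in \<open>auto simp: coad_def dual_def lin_map_def\<close>)
  have "bilin_map s L fscale (dual s L) fscale (dual s L) (coad L br)"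
    unfolding bilin_map_def lin_map_def
    by (auto simp: in_dual) (auto simp: coad_def fscale_def fun_eq_iff dual_def lin_map_def)
  moreover have "coad L br (br (\<beta> x) y) (dual_map L \<beta> v) =
      coad L br (\<alpha> (\<beta> x)) (coad L br y v) - coad L br (\<beta> y) (coad L br (\<alpha> x) v)"
    if "x \<in> L" "y \<in> L" "v \<in> dual s L" for x y v
  proof
    fix z
    have neg: "v (- u) = - v u" if "u \<in> L" for u
      using \<open>v \<in> dual s L\<close> lin_neg[OF _ vector_space_times that] by (auto simp: dual_def)
    have add: "v (u + w) = v u + v w" if "u \<in> L" "w \<in> L" for u w
      using \<open>v \<in> dual s L\<close> that by (auto simp: dual_def lin_map_def)
    have diff: "v (u - w) = v u - v w" if "u \<in> L" "w \<in> L" for u w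
      using add[of u "- w"] neg that by simp
    show "coad L br (br (\<beta> x) y) (dual_map L \<beta> v) z =
      (coad L br (\<alpha> (\<beta> x)) (coad L br y v) - coad L br (\<beta> y) (coad L br (\<alpha> x) v)) z"
    proof (cases "z \<in> L")
      case True
      with that br_module_identity[of x y z] show ?thesis by (simp add: coad_def dual_map_def diff)
    qed (simp add: coad_def)
  qed
  moreover have "dual_map L \<alpha> (coad L br x v) = coad L br (\<alpha> x) (dual_map L \<alpha> v)"
    "dual_map L \<beta> (coad L br x v) = coad L br (\<beta> x) (dual_map L \<beta> v)" if "x \<in> L" for x v
    using that by (auto simp: dual_map_def coad_def fun_eq_iff \<alpha>_br \<beta>_br)
  moreover have "dual_map L \<alpha> (dual_map L \<beta> v) = dual_map L \<beta> (dual_map L \<alpha> v)" for v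
    by (rule dual_map_commute) auto
  ultimately show ?thesis
    unfolding bihom_representation_def
    using alg fd_space_dual[OF fd] lin_dual_map[OF \<alpha>_lin carrier_space_axioms]
      lin_dual_map[OF \<beta>_lin carrier_space_axioms] by blast
qed

text \<open>
  The coadjoint action of an involutive BiHom-Lie algebra is always a representation, so the only
  conditions on \<open>S\<close> left in adjoint-admissibility are commutation with the structure maps and one
  identity; the compatibility of \<open>S\<^sup>*\<close> with \<open>ad\<^sup>*\<close> is that same identity evaluated by a functional.
  This is applied both to \<open>L\<close> and to its dual algebra, for which it avoids any computation in the
  bidual.
\<close>

lemma adjoint_admissible_iff:
  assumes nij: "involutive_nijenhuis_bihom_lie_algebra s L br N \<alpha> \<beta>" and S: "lin_endo s L S"
  shows "adjoint_admissible s L br N \<alpha> \<beta> S \<longleftrightarrow>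
    (\<forall>x\<in>L. S (\<alpha> x) = \<alpha> (S x)) \<and> (\<forall>x\<in>L. S (\<beta> x) = \<beta> (S x)) \<and>
    (\<forall>x\<in>L. \<forall>y\<in>L. S (br (N x) y) + br x (S (S y)) = br (N x) (S y) + S (br x (S y)))"
    (is "_ \<longleftrightarrow> ?comm \<alpha> \<and> ?comm \<beta> \<and> ?adm")
proof -
  interpret involutive_bihom_lie s L br \<alpha> \<beta>
    using nij by unfold_locales
      (auto simp: involutive_nijenhuis_bihom_lie_algebra_def nijenhuis_bihom_lie_algebra_def)
  have N: "lin_endo s L N"
    using nij by (simp add: involutive_nijenhuis_bihom_lie_algebra_def nijenhuis_bihom_lie_algebra_def)
  note N_simps [simp] = linD[OF N]
  note S_simps [simp] = linD[OF S]
  have comm: "(\<forall>v\<in>dual s L. dual_map L S (dual_map L f v) = dual_map L f (dual_map L S v)) \<longleftrightarrow> ?comm f"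
    (is "?d \<longleftrightarrow> _")
    if f: "lin_endo s L f" for f
  proof
    assume d: ?d
    show "?comm f"
    proof (intro ballI dual_separates[OF fd])
      fix x v assume "x \<in> L" "v \<in> dual s L"
      with d have "dual_map L S (dual_map L f v) x = dual_map L f (dual_map L S v) x" by simp
      with \<open>x \<in> L\<close> linD[OF f] show "v (S (f x)) = v (f (S x))" by (simp add: dual_map_def)
    qed (auto simp: linD[OF f])
  qed (auto intro: dual_map_commute simp: linD[OF f])
  have "coad L br (N x) (dual_map L S v) = dual_map L S (coad L br (N x) v)
      + dual_map L S (coad L br x (dual_map L S v)) - dual_map L S (dual_map L S (coad L br x v))"
    if adm: ?adm and "x \<in> L" "v \<in> dual s L" for x v
  proof
    fix y
    have "v (S (br (N x) y)) + v (br x (S (S y))) = v (br (N x) (S y)) + v (S (br x (S y)))" if "y \<in> L"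
    proof -
      have "v (S (br (N x) y) + br x (S (S y))) = v (br (N x) (S y) + S (br x (S y)))"
        using adm \<open>x \<in> L\<close> that by simp
      then show ?thesis using \<open>x \<in> L\<close> \<open>v \<in> dual s L\<close> that by (simp add: dual_def lin_add[of s L "(*)" UNIV v])
    qed
    then show "coad L br (N x) (dual_map L S v) y = (dual_map L S (coad L br (N x) v)
      + dual_map L S (coad L br x (dual_map L S v)) - dual_map L S (dual_map L S (coad L br x v))) y"
      using that by (simp add: coad_def dual_map_def algebra_simps)
  qed
  then show ?thesis
    using nij S comm[OF \<alpha>_lin] comm[OF \<beta>_lin] coadjoint_representation
      lin_dual_map[OF S carrier_space_axioms]
    unfolding adjoint_admissible_def nijenhuis_representation_def
      involutive_nijenhuis_bihom_lie_algebra_def by blast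
qed

section \<open>The dual of a BiHom-Lie coalgebra\<close>

context carrier_space begin

lemma bilin_form_product:
  "a \<in> dual s V \<Longrightarrow> b \<in> dual s V \<Longrightarrow> bilin_form s V (\<lambda>y z. a y * b z)"
  by (auto simp: dual_def bilin_map_def lin_map_def algebra_simps)

lemma trilin_form_product:
  "a \<in> dual s V \<Longrightarrow> b \<in> dual s V \<Longrightarrow> c \<in> dual s V \<Longrightarrow> trilin_form s V (\<lambda>x y z. a x * (b y * c z))"
  by (auto simp: trilin_form_def dual_def bilin_map_def lin_map_def algebra_simps)

lemma tensor_add:
  assumes "t \<in> tensor_square s V" "bilin_form s V B" "bilin_form s V C"
    "\<And>x y. x \<in> V \<Longrightarrow> y \<in> V \<Longrightarrow> D x y = B x y + C x y"
  shows "t D = t B + t C"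
proof -
  have "bilin_form s V D = bilin_form s V (\<lambda>x y. B x y + C x y)"
    by (rule bilin_form_cong) (rule assms(4))
  moreover have "bilin_form s V (\<lambda>x y. B x y + C x y)"
    using bilinD[OF assms(2)] bilinD[OF assms(3)]
    by (simp add: bilin_map_def lin_map_def algebra_simps)
  ultimately show ?thesis using tensor_square_add assms by blast
qed

lemma tensor_scale:
  assumes "t \<in> tensor_square s V" "bilin_form s V B"
    "\<And>x y. x \<in> V \<Longrightarrow> y \<in> V \<Longrightarrow> D x y = k * B x y"
  shows "t D = k * t B"
proof -
  have "bilin_form s V D = bilin_form s V (\<lambda>x y. k * B x y)"
    by (rule bilin_form_cong) (rule assms(3))
  moreover have "bilin_form s V (\<lambda>x y. k * B x y)"
    using bilinD[OF assms(2)] by (simp add: bilin_map_def lin_map_def algebra_simps)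
  ultimately show ?thesis using tensor_square_scale assms by blast
qed

end

lemma cojac_apply:
  assumes "lin_endo s L \<alpha>" "lin_endo s L \<beta>" "trilin_form s L T"
  shows "cojac s L \<Delta> \<alpha> \<beta> x T = \<Delta> x (\<lambda>y z. \<Delta> z (\<lambda>u v. T (\<beta> (\<beta> y)) (\<beta> u) (\<alpha> v)))"
proof -
  have "lin_endo s L id" by (simp add: lin_map_def)
  from trilin_form_comp[OF this assms(2,1,3)] assms(3) show ?thesis
    by (simp add: cojac_def tmap3_def tmap_cobr_def)
qed

locale bihom_lie_coalg =
  fixes s :: "'k::field \<Rightarrow> 'v::ab_group_add \<Rightarrow> 'v" and L :: "'v set"
    and \<Delta> :: "'v \<Rightarrow> ('k, 'v) tensor2" and \<alpha> \<beta> :: "'v \<Rightarrow> 'v"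
  assumes coalg: "bihom_lie_coalgebra s L \<Delta> \<alpha> \<beta>"
begin

lemma fd: "fd_space s L" using coalg by (simp add: bihom_lie_coalgebra_def)

sublocale carrier_space s L
  by (rule carrier_space_of_fd[OF fd])

sublocale dual: carrier_space fscale "dual s L"
  by (rule carrier_space_dual)

lemma \<alpha>_lin: "lin_endo s L \<alpha>" and \<beta>_lin: "lin_endo s L \<beta>"
  and \<Delta>_lin: "lin_map s L fscale (tensor_square s L) \<Delta>"
  using coalg unfolding bihom_lie_coalgebra_def by blast+

lemmas \<alpha>_simps [simp] = linD[OF \<alpha>_lin]
lemmas \<beta>_simps [simp] = linD[OF \<beta>_lin]
lemmas \<Delta>_simps [simp] = linD[OF \<Delta>_lin]

abbreviation "dbr \<equiv> dual_cobr L \<Delta>"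

lemma dbr_apply: "x \<in> L \<Longrightarrow> dbr a b x = \<Delta> x (\<lambda>y z. a y * b z)"
  by (simp add: dual_cobr_def)

lemma dbr_in [simp]: "a \<in> dual s L \<Longrightarrow> b \<in> dual s L \<Longrightarrow> dbr a b \<in> dual s L"
  by (rule dualI[of _ _ "\<lambda>x. \<Delta> x (\<lambda>y z. a y * b z)"])
    (auto simp: dual_cobr_def lin_map_def fscale_def intro: carrier_space_axioms)

lemma dbr_bilin: "bilin_map fscale (dual s L) fscale (dual s L) fscale (dual s L) dbr"
proof -
  have addl: "dbr (a + a') b = dbr a b + dbr a' b" and addr: "dbr b (a + a') = dbr b a + dbr b a'"
    if "a \<in> dual s L" "a' \<in> dual s L" "b \<in> dual s L" for a a' b
  proof -
    have "\<Delta> x (\<lambda>y z. (a + a') y * b z) = \<Delta> x (\<lambda>y z. a y * b z) + \<Delta> x (\<lambda>y z. a' y * b z)"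
      if "x \<in> L" for x
      by (rule tensor_add[OF \<Delta>_simps(1)[OF that] bilin_form_product bilin_form_product])
        (use \<open>a \<in> _\<close> \<open>a' \<in> _\<close> \<open>b \<in> _\<close> in \<open>simp_all add: algebra_simps\<close>)
    then show "dbr (a + a') b = dbr a b + dbr a' b"
      by (intro ext) (simp add: dual_cobr_def)
    have "\<Delta> x (\<lambda>y z. b y * (a + a') z) = \<Delta> x (\<lambda>y z. b y * a z) + \<Delta> x (\<lambda>y z. b y * a' z)"
      if "x \<in> L" for x
      by (rule tensor_add[OF \<Delta>_simps(1)[OF that] bilin_form_product bilin_form_product])
        (use \<open>a \<in> _\<close> \<open>a' \<in> _\<close> \<open>b \<in> _\<close> in \<open>simp_all add: algebra_simps\<close>)
    then show "dbr b (a + a') = dbr b a + dbr b a'"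
      by (intro ext) (simp add: dual_cobr_def)
  qed
  have scl: "dbr (fscale c a) b = fscale c (dbr a b)" and scr: "dbr a (fscale c b) = fscale c (dbr a b)"
    if "a \<in> dual s L" "b \<in> dual s L" for a b c
  proof -
    have "\<Delta> x (\<lambda>y z. fscale c a y * b z) = c * \<Delta> x (\<lambda>y z. a y * b z)" if "x \<in> L" for x
      by (rule tensor_scale[OF \<Delta>_simps(1)[OF that] bilin_form_product])
        (use \<open>a \<in> _\<close> \<open>b \<in> _\<close> in \<open>simp_all add: fscale_def\<close>)
    then show "dbr (fscale c a) b = fscale c (dbr a b)"
      by (intro ext) (simp add: dual_cobr_def fscale_def)
    have "\<Delta> x (\<lambda>y z. a y * fscale c b z) = c * \<Delta> x (\<lambda>y z. a y * b z)" if "x \<in> L" for x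
      by (rule tensor_scale[OF \<Delta>_simps(1)[OF that] bilin_form_product])
        (use \<open>a \<in> _\<close> \<open>b \<in> _\<close> in \<open>simp_all add: fscale_def\<close>)
    then show "dbr a (fscale c b) = fscale c (dbr a b)"
      by (intro ext) (simp add: dual_cobr_def fscale_def)
  qed
  show ?thesis by (simp add: bilin_map_def lin_map_def addl addr scl scr)
qed

lemma dbr_dual_map:
  assumes "x \<in> L"
  shows "dbr (dual_map L f a) (dual_map L g b) x = \<Delta> x (\<lambda>y z. a (f y) * b (g z))"
  unfolding dbr_apply[OF assms]
  by (rule tensor_cong) (use assms in \<open>auto simp: dual_map_def\<close>)

lemma dbr_dual_map_left:
  assumes "x \<in> L"
  shows "dbr (dual_map L f a) b x = \<Delta> x (\<lambda>y z. a (f y) * b z)"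
  unfolding dbr_apply[OF assms]
  by (rule tensor_cong) (use assms in \<open>auto simp: dual_map_def\<close>)

lemma dbr_dual_map_right:
  assumes "x \<in> L"
  shows "dbr a (dual_map L g b) x = \<Delta> x (\<lambda>y z. a y * b (g z))"
  unfolding dbr_apply[OF assms]
  by (rule tensor_cong) (use assms in \<open>auto simp: dual_map_def\<close>)

text \<open>
  Nested brackets of functionals are values of the iterated cobracket on product forms.  Hence the
  Jacobi identity of the dual is the co-Jacobi identity read on \<open>a \<otimes> b \<otimes> c\<close>, the two permuted copies
  of \<open>cojac\<close> supplying the cyclic permutations.
\<close>

lemma dbr_jacobi_term:
  assumes "x \<in> L" "a \<in> dual s L" "b \<in> dual s L" "c \<in> dual s L"
  shows "dbr (dual_map L \<beta> (dual_map L \<beta> a)) (dbr (dual_map L \<beta> b) (dual_map L \<alpha> c)) x =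
    cojac s L \<Delta> \<alpha> \<beta> x (\<lambda>y u v. a y * (b u * c v))"
proof -
  have "dbr (dual_map L \<beta> (dual_map L \<beta> a)) (dbr (dual_map L \<beta> b) (dual_map L \<alpha> c)) x =
    \<Delta> x (\<lambda>y z. \<Delta> z (\<lambda>u v. a (\<beta> (\<beta> y)) * (b (\<beta> u) * c (\<alpha> v))))"
    unfolding dbr_apply[OF assms(1)]
  proof (rule tensor_cong[OF \<Delta>_simps(1)[OF assms(1)]])
    fix y z assume yz: "y \<in> L" "z \<in> L"
    have "\<Delta> z (\<lambda>u v. a (\<beta> (\<beta> y)) * (b (\<beta> u) * c (\<alpha> v))) = a (\<beta> (\<beta> y)) * \<Delta> z (\<lambda>u v. b (\<beta> u) * c (\<alpha> v))"
      by (rule tensor_scale[OF _ bilin_form_comp[OF \<beta>_lin \<alpha>_lin bilin_form_product[OF assms(3,4)]]])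
        (use yz in auto)
    then show "dual_map L \<beta> (dual_map L \<beta> a) y * dbr (dual_map L \<beta> b) (dual_map L \<alpha> c) z =
      \<Delta> z (\<lambda>u v. a (\<beta> (\<beta> y)) * (b (\<beta> u) * c (\<alpha> v)))"
      using yz by (simp add: dbr_dual_map) (simp add: dual_map_def)
  qed
  then show ?thesis
    using assms by (simp add: cojac_apply[OF \<alpha>_lin \<beta>_lin trilin_form_product])
qed

lemma dual_bihom_lie_algebra:
  "bihom_lie_algebra fscale (dual s L) dbr (dual_map L \<alpha>) (dual_map L \<beta>)"
proof -
  have comm: "\<alpha> (\<beta> x) = \<beta> (\<alpha> x)"
    and \<Delta>\<alpha>: "\<Delta> (\<alpha> x) = tmap2 s L \<alpha> \<alpha> (\<Delta> x)" and \<Delta>\<beta>: "\<Delta> (\<beta> x) = tmap2 s L \<beta> \<beta> (\<Delta> x)"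
    and coskew: "tmap2 s L \<beta> \<alpha> (\<Delta> x) + flip2 (tmap2 s L \<beta> \<alpha> (\<Delta> x)) = 0"
    and cojacobi: "cojac s L \<Delta> \<alpha> \<beta> x + flip12 (flip23 (cojac s L \<Delta> \<alpha> \<beta> x))
      + flip23 (flip12 (cojac s L \<Delta> \<alpha> \<beta> x)) = 0" if "x \<in> L" for x
    using coalg that unfolding bihom_lie_coalgebra_def Let_def by blast+
  have mult: "dual_map L f (dbr a b) = dbr (dual_map L f a) (dual_map L f b)"
    if "lin_endo s L f" "\<And>x. x \<in> L \<Longrightarrow> \<Delta> (f x) = tmap2 s L f f (\<Delta> x)" "a \<in> dual s L" "b \<in> dual s L" 
    for a b f
  proof
    fix x show "dual_map L f (dbr a b) x = dbr (dual_map L f a) (dual_map L f b) x"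
    proof (cases "x \<in> L")
      case True
      then have "dbr (dual_map L f a) (dual_map L f b) x = dbr a b (f x)"
        using that bilin_form_product[OF that(3,4)] lin_closed[OF that(1)]
        by (simp add: dbr_dual_map dbr_apply[of "f x"] tmap2_def)
      then show ?thesis using True by (simp add: dual_map_def)
    qed (simp add: dual_map_def dual_cobr_def)
  qed
  moreover have "dbr (dual_map L \<beta> a) (dual_map L \<alpha> b) = - dbr (dual_map L \<beta> b) (dual_map L \<alpha> a)"
    if ab: "a \<in> dual s L" "b \<in> dual s L" for a b
  proof
    fix x show "dbr (dual_map L \<beta> a) (dual_map L \<alpha> b) x = (- dbr (dual_map L \<beta> b) (dual_map L \<alpha> a)) x"
    proof (cases "x \<in> L")
      case True
      have "(tmap2 s L \<beta> \<alpha> (\<Delta> x) + flip2 (tmap2 s L \<beta> \<alpha> (\<Delta> x))) (\<lambda>y z. a y * b z) = 0"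
        using coskew[OF True] by simp
      moreover have "(\<lambda>y z. a z * b y) = (\<lambda>y z. b y * a z)"
        "(\<lambda>y z. b (\<beta> y) * a (\<alpha> z)) = (\<lambda>y z. a (\<alpha> z) * b (\<beta> y))" by (simp_all add: fun_eq_iff)
      ultimately show ?thesis
        using True bilin_form_product[OF ab] bilin_form_product[OF ab(2,1)]
        by (simp add: tmap2_def flip2_def dbr_dual_map eq_neg_iff_add_eq_0)
    qed (simp add: dual_cobr_def)
  qed
  moreover have "dbr (dual_map L \<beta> (dual_map L \<beta> a)) (dbr (dual_map L \<beta> b) (dual_map L \<alpha> c))
      + dbr (dual_map L \<beta> (dual_map L \<beta> b)) (dbr (dual_map L \<beta> c) (dual_map L \<alpha> a))
      + dbr (dual_map L \<beta> (dual_map L \<beta> c)) (dbr (dual_map L \<beta> a) (dual_map L \<alpha> b)) = 0"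
    if abc: "a \<in> dual s L" "b \<in> dual s L" "c \<in> dual s L" for a b c
  proof
    fix x
    show "(dbr (dual_map L \<beta> (dual_map L \<beta> a)) (dbr (dual_map L \<beta> b) (dual_map L \<alpha> c))
      + dbr (dual_map L \<beta> (dual_map L \<beta> b)) (dbr (dual_map L \<beta> c) (dual_map L \<alpha> a))
      + dbr (dual_map L \<beta> (dual_map L \<beta> c)) (dbr (dual_map L \<beta> a) (dual_map L \<alpha> b))) x = 0 x"
    proof (cases "x \<in> L")
      case True
      have "(\<lambda>x y z. b x * (c y * a z)) = (\<lambda>x y z. a z * (b x * c y))"
        "(\<lambda>x y z. c x * (a y * b z)) = (\<lambda>x y z. a y * (b z * c x))" by (auto simp: fun_eq_iff)
      then show ?thesis
        using fun_cong[OF cojacobi[OF True], of "\<lambda>x y z. a x * (b y * c z)"] True abc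
        by (simp add: dbr_jacobi_term flip12_def flip23_def)
    qed (simp add: dual_cobr_def)
  qed
  moreover have "dual_map L \<alpha> (dual_map L \<beta> a) = dual_map L \<beta> (dual_map L \<alpha> a)" for a
    by (rule dual_map_commute) (auto simp: comm)
  ultimately show ?thesis
    unfolding bihom_lie_algebra_def
    using fd_space_dual[OF fd] dbr_bilin lin_dual_map[OF \<alpha>_lin carrier_space_axioms]
      lin_dual_map[OF \<beta>_lin carrier_space_axioms] mult[OF \<alpha>_lin \<Delta>\<alpha>] mult[OF \<beta>_lin \<Delta>\<beta>] by blast
qed

lemma dual_nijenhuis:
  assumes co: "nijenhuis_bihom_lie_coalgebra s L \<Delta> S \<alpha> \<beta>"
    and comm: "\<And>x. x \<in> L \<Longrightarrow> S (\<alpha> x) = \<alpha> (S x)" "\<And>x. x \<in> L \<Longrightarrow> S (\<beta> x) = \<beta> (S x)"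
  shows "nijenhuis_bihom_lie_algebra fscale (dual s L) dbr (dual_map L S) (dual_map L \<alpha>) (dual_map L \<beta>)"
proof -
  have S: "lin_endo s L S"
    and nij: "\<And>x. x \<in> L \<Longrightarrow> tmap2 s L S S (\<Delta> x) + \<Delta> (S (S x)) =
      tmap2 s L S id (\<Delta> (S x)) + tmap2 s L id S (\<Delta> (S x))"
    using co unfolding nijenhuis_bihom_lie_coalgebra_def by blast+
  note S_simps [simp] = linD[OF S]
  have "dbr (dual_map L S a) (dual_map L S b) =
    dual_map L S (dbr (dual_map L S a) b + dbr a (dual_map L S b)) - dual_map L S (dual_map L S (dbr a b))"
    if ab: "a \<in> dual s L" "b \<in> dual s L" for a b
  proof
    fix x
    show "dbr (dual_map L S a) (dual_map L S b) x = (dual_map L S (dbr (dual_map L S a) b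
      + dbr a (dual_map L S b)) - dual_map L S (dual_map L S (dbr a b))) x"
    proof (cases "x \<in> L")
      case True
      have "\<Delta> x (\<lambda>y z. a (S y) * b (S z)) + \<Delta> (S (S x)) (\<lambda>y z. a y * b z) =
        \<Delta> (S x) (\<lambda>y z. a (S y) * b z) + \<Delta> (S x) (\<lambda>y z. a y * b (S z))"
        using fun_cong[OF nij[OF True], of "\<lambda>y z. a y * b z"] bilin_form_product[OF ab]
        by (simp add: tmap2_def)
      moreover have "dual_map L S (dbr (dual_map L S a) b + dbr a (dual_map L S b)) x =
        \<Delta> (S x) (\<lambda>y z. a (S y) * b z) + \<Delta> (S x) (\<lambda>y z. a y * b (S z))"
        using True by (simp add: dual_map_def[of L S "_ + _"] dbr_dual_map_left dbr_dual_map_right)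
      moreover have "dual_map L S (dual_map L S (dbr a b)) x = \<Delta> (S (S x)) (\<lambda>y z. a y * b z)"
        using True by (simp add: dual_map_def dbr_apply)
      ultimately show ?thesis
        using True by (simp add: dbr_dual_map eq_diff_eq)
    qed (simp add: dual_map_def dual_cobr_def)
  qed
  moreover have "dual_map L S (dual_map L \<alpha> a) = dual_map L \<alpha> (dual_map L S a)"
    "dual_map L S (dual_map L \<beta> a) = dual_map L \<beta> (dual_map L S a)" for a
    by (rule dual_map_commute; simp add: comm)+
  ultimately show ?thesis
    unfolding nijenhuis_bihom_lie_algebra_def
    using dual_bihom_lie_algebra lin_dual_map[OF S carrier_space_axioms] by blast
qed

end

section \<open>Coboundaries on Lie algebras\<close>

locale skew_tensor = carrier_lie_algebra s L lb
  for s :: "'k::field \<Rightarrow> 'v::ab_group_add \<Rightarrow> 'v" and L :: "'v set" and lb :: "'v \<Rightarrow> 'v \<Rightarrow> 'v" +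
  fixes I :: "'i set" and p q :: "'i \<Rightarrow> 'v"
  assumes p_in [simp]: "p i \<in> L" and q_in [simp]: "q i \<in> L"
    and skew: "bilin_form s L B \<Longrightarrow> (\<Sum>i\<in>I. B (q i) (p i)) = - (\<Sum>i\<in>I. B (p i) (q i))"
begin

text \<open>
  The coboundary \<open>x \<mapsto> x \<cdot> r\<close> of the tensor \<open>r = \<Sum>i. p i \<otimes> q i\<close>, evaluated on bilinear forms.
\<close>

definition cob :: "'v \<Rightarrow> ('k, 'v) tensor2" where
  "cob x B = (\<Sum>i\<in>I. B (lb x (p i)) (q i) + B (p i) (lb x (q i)))"

text \<open>
  The value of \<open>r \<otimes> r\<close> on a function of four vectors; the arguments are \<open>r1, r2\<close> of the first
  copy, then of the second.
\<close>

definition dsum :: "('v \<Rightarrow> 'v \<Rightarrow> 'v \<Rightarrow> 'v \<Rightarrow> 'k) \<Rightarrow> 'k" where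
  "dsum Q = (\<Sum>i\<in>I. \<Sum>j\<in>I. Q (p i) (q i) (p j) (q j))"

lemma cob_cong:
  assumes "x \<in> L" "\<And>u v. u \<in> L \<Longrightarrow> v \<in> L \<Longrightarrow> B u v = C u v"
  shows "cob x B = cob x C"
  using assms by (simp add: cob_def)

lemma cob_form_add: "cob x (\<lambda>u v. B u v + C u v) = cob x B + cob x C"
  by (simp add: cob_def sum.distrib algebra_simps)

lemma cob_add: "bilin_form s L B \<Longrightarrow> x \<in> L \<Longrightarrow> y \<in> L \<Longrightarrow> cob (x + y) B = cob x B + cob y B"
  by (simp add: cob_def bilin_add_left bilin_add_right sum.distrib algebra_simps)

lemma cob_scale: "bilin_form s L B \<Longrightarrow> x \<in> L \<Longrightarrow> cob (s c x) B = c * cob x B"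
  by (simp add: cob_def bilin_scale_left bilin_scale_right sum_distrib_left algebra_simps)

lemma cob_swap:
  assumes "bilin_form s L B" "x \<in> L"
  shows "cob x (\<lambda>u v. B v u) = - cob x B"
proof -
  have "bilin_form s L (\<lambda>u v. B (lb x u) v)" "bilin_form s L (\<lambda>u v. B u (lb x v))"
    using assms bilinD[OF assms(1)] by (simp_all add: bilin_map_def lin_map_def)
  from this[THEN skew] show ?thesis by (simp add: cob_def sum.distrib)
qed

lemma cob_cocycle:
  assumes "bilin_form s L B" "x \<in> L" "y \<in> L"
  shows "cob (lb x y) B = cob y (\<lambda>u v. B (lb x u) v + B u (lb x v))
    - cob x (\<lambda>u v. B (lb y u) v + B u (lb y v))"
  unfolding cob_def sum_subtractf[symmetric] using assms(2,3)
  by (intro sum.cong refl)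
    (simp add: lb_leibniz[OF assms(2,3)] bilin_add_left[OF assms(1)] bilin_add_right[OF assms(1)])

text \<open>
  An automorphism \<open>f\<close> fixing \<open>r\<close> satisfies \<open>\<delta> f = (f \<otimes> f) \<delta>\<close>.
\<close>

lemma cob_equivariant:
  assumes f: "lin_endo s L f" and hom: "\<And>u v. u \<in> L \<Longrightarrow> v \<in> L \<Longrightarrow> f (lb u v) = lb (f u) (f v)"
    and inv: "\<And>B. bilin_form s L B \<Longrightarrow> (\<Sum>i\<in>I. B (f (p i)) (f (q i))) = (\<Sum>i\<in>I. B (p i) (q i))"
    and B: "bilin_form s L B" and x: "x \<in> L"
  shows "cob (f x) B = cob x (\<lambda>u v. B (f u) (f v))"
proof -
  note [simp] = bilinD[OF B] linD[OF f] x
  have "bilin_form s L (\<lambda>u v. B (lb (f x) u) v + B u (lb (f x) v))"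
    by (simp add: bilin_map_def lin_map_def algebra_simps)
  from inv[OF this] show ?thesis by (simp add: cob_def hom)
qed

lemma dsum_cong:
  assumes "\<And>a b c d. a \<in> L \<Longrightarrow> b \<in> L \<Longrightarrow> c \<in> L \<Longrightarrow> d \<in> L \<Longrightarrow> Q a b c d = R a b c d"
  shows "dsum Q = dsum R"
  using assms by (simp add: dsum_def)

lemma dsum_add: "dsum (\<lambda>a b c d. Q a b c d + R a b c d) = dsum Q + dsum R"
  by (simp add: dsum_def sum.distrib)

lemma dsum_neg: "dsum (\<lambda>a b c d. - Q a b c d) = - dsum Q"
  by (simp add: dsum_def sum_negf)

lemma dsum_swap: "dsum (\<lambda>a b c d. Q c d a b) = dsum Q"
  unfolding dsum_def by (rule sum.swap)

lemma dsum_skew: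
  assumes "\<And>c d. c \<in> L \<Longrightarrow> d \<in> L \<Longrightarrow> bilin_form s L (\<lambda>a b. Q a b c d)"
  shows "dsum (\<lambda>a b c d. Q b a c d) = - dsum Q"
proof -
  have "dsum (\<lambda>a b c d. Q b a c d) = (\<Sum>j\<in>I. \<Sum>i\<in>I. Q (q i) (p i) (p j) (q j))"
    unfolding dsum_def by (rule sum.swap)
  also have "\<dots> = - (\<Sum>j\<in>I. \<Sum>i\<in>I. Q (p i) (q i) (p j) (q j))"
    using skew[OF assms] by (simp add: sum_negf)
  also have "\<dots> = - dsum Q" unfolding dsum_def by (subst sum.swap) simp
  finally show ?thesis .
qed

lemma bilin_cob:
  assumes T: "trilin_form s L T"
  shows "bilin_form s L (\<lambda>u v. cob v (T u))"
proof -
  note [simp] = trilinD[OF T]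
  show ?thesis
    unfolding bilin_map_def lin_map_def cob_def
    by (auto simp: sum.distrib sum_distrib_left algebra_simps)
qed

lemma cob_cob:
  assumes T: "trilin_form s L T" and x: "x \<in> L"
  shows "cob x (\<lambda>u v. cob v (T u)) =
    dsum (\<lambda>a b c d. T (lb x a) (lb b c) d) + dsum (\<lambda>a b c d. T (lb x a) c (lb b d))
    + dsum (\<lambda>a b c d. T a (lb (lb x b) c) d) + dsum (\<lambda>a b c d. T a c (lb (lb x b) d))"
  by (simp add: cob_def dsum_def sum.distrib algebra_simps)

text \<open>
  Drinfeld's observation: the cyclic sum of \<open>(id \<otimes> \<delta>) \<delta>(x)\<close> equals \<open>x \<cdot> CYB(r)\<close> when \<open>r\<close> is
  skew.  Both sides are sums of values of \<open>r \<otimes> r\<close>.  The action of \<open>x\<close> on the three slots of \<open>CYB(r)\<close> gives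
  nine terms; the cyclic sum gives twelve.  Six of the twelve have \<open>x\<close> and a bracket of
  two components of \<open>r\<close> in different slots and match six of the nine after a use of skewness and an exchange of the
  copies of \<open>r\<close>.  The other six have a double bracket and combine in pairs, by the Leibniz rule, to
  the remaining three.
\<close>

lemma cob_cojacobi:
  assumes cybe: "\<And>T. trilin_form s L T \<Longrightarrow>
      dsum (\<lambda>a b c d. T (lb a c) b d + T a (lb b c) d + T a c (lb b d)) = 0"
    and T: "trilin_form s L T" and x [simp]: "x \<in> L"
  shows "cob x (\<lambda>u v. cob v (T u)) + cob x (\<lambda>u v. cob v (\<lambda>w z. T z u w))
    + cob x (\<lambda>u v. cob v (\<lambda>w z. T w z u)) = 0"
proof -
  note [simp] = trilinD[OF T] trilin_form_neg[OF T]
  note bil = bilin_map_def lin_map_def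
  have T1: "trilin_form s L (\<lambda>u w z. T z u w)" and T2: "trilin_form s L (\<lambda>u w z. T w z u)"
    by (simp_all add: trilin_form_def bil)
  have xT: "trilin_form s L (\<lambda>u v w. T (lb x u) v w + T u (lb x v) w + T u v (lb x w))"
    by (simp add: trilin_form_def bil algebra_simps)
  have sk: "T (lb u v) w z = - T (lb v u) w z" "T w (lb u v) z = - T w (lb v u) z"
    "T w z (lb u v) = - T w z (lb v u)" if "u \<in> L" "v \<in> L" "w \<in> L" "z \<in> L" for u v w z
    using that by (subst lb_skew[of u v]; simp)+
  have leib: "lb x (lb u v) = lb (lb x u) v - lb (lb x v) u" if "u \<in> L" "v \<in> L" for u v
    using lb_leibniz[OF x that] lb_skew[of u "lb x v"] that by simp
  \<comment> \<open>Renaming to a common pattern: flip the first copy of \<open>r\<close>, or both, then exchange the copies.\<close>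
  have skew_swap: "dsum (\<lambda>a b c d. Q b a c d) = dsum R"
    if "\<And>c d. c \<in> L \<Longrightarrow> d \<in> L \<Longrightarrow> bilin_form s L (\<lambda>a b. Q a b c d)"
      "\<And>a b c d. a \<in> L \<Longrightarrow> b \<in> L \<Longrightarrow> c \<in> L \<Longrightarrow> d \<in> L \<Longrightarrow> R a b c d = - Q c d a b" for Q R
  proof -
    have "dsum R = dsum (\<lambda>a b c d. - Q c d a b)" by (rule dsum_cong) (rule that(2))
    also have "\<dots> = - dsum Q" unfolding dsum_neg by (rule arg_cong[where f = uminus], rule dsum_swap)
    also have "\<dots> = dsum (\<lambda>a b c d. Q b a c d)" by (rule dsum_skew[symmetric]) (rule that(1))
    finally show ?thesis by (rule sym)
  qed
  have skew_both: "dsum (\<lambda>a b c d. Q b a d c) = dsum Q"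
    if "\<And>c d. c \<in> L \<Longrightarrow> d \<in> L \<Longrightarrow> bilin_form s L (\<lambda>a b. Q a b c d)"
      "\<And>a b. a \<in> L \<Longrightarrow> b \<in> L \<Longrightarrow> bilin_form s L (\<lambda>c d. Q a b c d)" for Q
  proof -
    have "dsum (\<lambda>a b c d. Q b a d c) = - dsum (\<lambda>a b c d. Q a b d c)"
      by (rule dsum_skew) (rule that(1))
    also have "dsum (\<lambda>a b c d. Q a b d c) = dsum (\<lambda>a b c d. Q c d b a)"
      by (rule dsum_swap[symmetric])
    also have "\<dots> = - dsum (\<lambda>a b c d. Q c d a b)"
      by (rule dsum_skew) (rule that(2))
    also have "dsum (\<lambda>a b c d. Q c d a b) = dsum Q" by (rule dsum_swap)
    finally show ?thesis by simp
  qed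
  have bil_minus: "T (u - u') w z = T u w z - T u' w z" "T w (u - u') z = T w u z - T w u' z"
    "T w z (u - u') = T w z u - T w z u'" if "u \<in> L" "u' \<in> L" "w \<in> L" "z \<in> L" for u u' w z
    using that trilin_add1[OF T, of u w z "- u'"] trilin_add2[OF T, of w u z "- u'"]
      trilin_add3[OF T, of w z u "- u'"] by simp_all
  \<comment> \<open>Pairs of double brackets that add up to \<open>x\<close> acting on a bracket, in slot 1, 2, 3 respectively.\<close>
  have t1: "dsum (\<lambda>a b c d. T (lb x (lb a c)) b d)
      = dsum (\<lambda>a b c d. T (lb (lb x b) d) a c) + dsum (\<lambda>a b c d. T (lb (lb x b) c) d a)"
  proof -
    have "dsum (\<lambda>a b c d. T (lb (lb x b) d) a c) = dsum (\<lambda>a b c d. T (lb (lb x a) c) b d)"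
      by (rule skew_both) (simp_all add: bil)
    moreover have "dsum (\<lambda>a b c d. T (lb (lb x b) c) d a) = dsum (\<lambda>a b c d. - T (lb (lb x c) a) b d)"
      by (rule skew_swap) (simp_all add: bil)
    moreover have "dsum (\<lambda>a b c d. T (lb x (lb a c)) b d) = dsum (\<lambda>a b c d. (T (lb (lb x a) c) b d) + (- T (lb (lb x c) a) b d))"
      by (rule dsum_cong) (simp add: leib bil_minus)
    ultimately show ?thesis by (simp only: dsum_add)
  qed
  have t5: "dsum (\<lambda>a b c d. T a (lb x (lb b c)) d)
      = dsum (\<lambda>a b c d. T a (lb (lb x b) c) d) + dsum (\<lambda>a b c d. T c (lb (lb x b) d) a)"
  proof -
    have "dsum (\<lambda>a b c d. T c (lb (lb x b) d) a) = dsum (\<lambda>a b c d. - T a (lb (lb x c) b) d)"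
      by (rule skew_swap) (simp_all add: bil)
    moreover have "dsum (\<lambda>a b c d. T a (lb x (lb b c)) d) = dsum (\<lambda>a b c d. (T a (lb (lb x b) c) d) + (- T a (lb (lb x c) b) d))"
      by (rule dsum_cong) (simp add: leib bil_minus)
    ultimately show ?thesis by (simp only: dsum_add)
  qed
  have t9: "dsum (\<lambda>a b c d. T a c (lb x (lb b d)))
      = dsum (\<lambda>a b c d. T a c (lb (lb x b) d)) + dsum (\<lambda>a b c d. T d a (lb (lb x b) c))"
  proof -
    have "dsum (\<lambda>a b c d. T d a (lb (lb x b) c)) = dsum (\<lambda>a b c d. T b c (lb (lb x d) a))" by (rule dsum_swap)
    also have "\<dots> = - dsum (\<lambda>a b c d. T a c (lb (lb x d) b))"
      by (rule dsum_skew) (simp add: bil)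
    finally have "dsum (\<lambda>a b c d. T d a (lb (lb x b) c)) = dsum (\<lambda>a b c d. - T a c (lb (lb x d) b))"
      by (simp only: dsum_neg)
    moreover have "dsum (\<lambda>a b c d. T a c (lb x (lb b d))) = dsum (\<lambda>a b c d. T a c (lb (lb x b) d) + (- T a c (lb (lb x d) b)))"
      by (rule dsum_cong) (simp add: leib bil_minus)
    ultimately show ?thesis by (simp only: dsum_add)
  qed
  \<comment> \<open>Terms with \<open>x\<close> and the bracket in different slots.\<close>
  have t2: "dsum (\<lambda>a b c d. T (lb b d) (lb x a) c) = dsum (\<lambda>a b c d. T (lb a c) (lb x b) d)"
    by (rule skew_both) (simp_all add: bil)
  have t3: "dsum (\<lambda>a b c d. T (lb b c) d (lb x a))
      = dsum (\<lambda>a b c d. T (lb a c) b (lb x d))"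
    by (rule skew_swap) (simp add: bil, subst sk(1), simp_all)
  have t6: "dsum (\<lambda>a b c d. T c (lb b d) (lb x a))
      = dsum (\<lambda>a b c d. T a (lb b c) (lb x d))"
    by (rule skew_swap) (simp add: bil, subst sk(2), simp_all)
  have "dsum (\<lambda>a b c d. T d (lb x a) (lb b c)) = dsum (\<lambda>a b c d. T b (lb x c) (lb d a))" by (rule dsum_swap)
  also have "\<dots> = - dsum (\<lambda>a b c d. T a (lb x c) (lb d b))"
    by (rule dsum_skew) (simp add: bil)
  also have "\<dots> = dsum (\<lambda>a b c d. T a (lb x c) (lb b d))"
    unfolding dsum_neg[symmetric] by (rule dsum_cong) (subst sk(3), simp_all)
  finally have t8: "dsum (\<lambda>a b c d. T d (lb x a) (lb b c)) = dsum (\<lambda>a b c d. T a (lb x c) (lb b d))" .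
  show ?thesis
    using cybe[OF xT] unfolding cob_cob[OF T x] cob_cob[OF T1 x] cob_cob[OF T2 x] dsum_add t1 t2 t3 t5 t6 t8 t9
    by (simp add: algebra_simps)
qed
end

locale intertwined_skew_tensor = skew_tensor s L lb I p q
  for s :: "'k::field \<Rightarrow> 'v::ab_group_add \<Rightarrow> 'v" and L lb and I :: "'i set" and p q +
  fixes N S :: "'v \<Rightarrow> 'v"
  assumes N_lin: "lin_endo s L N" and S_lin: "lin_endo s L S"
    and intertwine: "bilin_form s L B \<Longrightarrow> (\<Sum>i\<in>I. B (S (p i)) (q i)) = (\<Sum>i\<in>I. B (p i) (N (q i)))"
    and nijenhuis: "x \<in> L \<Longrightarrow> y \<in> L \<Longrightarrow> lb (N x) (N y) = N (lb (N x) y + lb x (N y)) - N (N (lb x y))"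
    and admissible: "x \<in> L \<Longrightarrow> y \<in> L \<Longrightarrow>
      S (lb (N x) y) + lb x (S (S y)) = lb (N x) (S y) + S (lb x (S y))"
begin

lemmas N_simps [simp] = linD[OF N_lin] lin_neg[OF N_lin vs]
lemmas S_simps [simp] = linD[OF S_lin] lin_neg[OF S_lin vs]

text \<open>
  Since \<open>r\<close> is skew, \<open>(S \<otimes> id) r = (id \<otimes> N) r\<close> also holds with the two factors exchanged.
\<close>

lemma intertwine_flip:
  assumes B: "bilin_form s L B"
  shows "(\<Sum>i\<in>I. B (p i) (S (q i))) = (\<Sum>i\<in>I. B (N (p i)) (q i))"
proof -
  note [simp] = bilinD[OF B]
  have "bilin_form s L (\<lambda>u v. B u (S v))" "bilin_form s L (\<lambda>u v. B (N u) v)" "bilin_form s L (\<lambda>u v. B v u)"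
    by (simp_all add: bilin_map_def lin_map_def)
  from skew[OF this(1)] skew[OF this(2)] intertwine[OF this(3)] show ?thesis by simp
qed

lemma admissible_flip:
  assumes "x \<in> L" "y \<in> L"
  shows "S (lb x (N y)) + lb (S (S x)) y = lb (S x) (N y) + S (lb (S x) y)"
proof -
  have "lb x (N y) = - lb (N y) x" "lb (S (S x)) y = - lb y (S (S x))"
    "lb (S x) (N y) = - lb (N y) (S x)" "lb (S x) y = - lb y (S x)"
    using assms by (auto intro!: lb_skew)
  then show ?thesis using arg_cong[OF admissible[OF assms(2,1)], of uminus] assms by simp
qed

text \<open>
  The intertwining relations trade \<open>S\<close> on a factor of \<open>r\<close> for \<open>N\<close> on the other factor.  Doing so
  wherever \<open>S\<close> meets a bare component of \<open>r\<close> leaves an identity that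
  holds separately in each slot: it is admissibility of \<open>S\<close> with the arguments in the other order.
\<close>

lemma cob_conijenhuis:
  assumes B: "bilin_form s L B" and x [simp]: "x \<in> L"
  shows "cob x (\<lambda>u v. B (S u) (S v)) + cob (S (S x)) B =
    cob (S x) (\<lambda>u v. B (S u) v) + cob (S x) (\<lambda>u v. B u (S v))"
proof -
  note [simp] = bilinD[OF B]
  have b: "bilin_form s L (\<lambda>u v. B (S (lb x u)) v)" "bilin_form s L (\<lambda>u v. B u (S (lb x v)))"
    "bilin_form s L (\<lambda>u v. B (lb (S x) u) v)" "bilin_form s L (\<lambda>u v. B u (lb (S x) v))"
    by (simp_all add: bilin_map_def lin_map_def)
  have t: "B (S (lb x (N u))) v + B (lb (S (S x)) u) v = B (lb (S x) (N u)) v + B (S (lb (S x) u)) v"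
    "B v (S (lb x (N u))) + B v (lb (S (S x)) u) = B v (lb (S x) (N u)) + B v (S (lb (S x) u))"
    if "u \<in> L" "v \<in> L" for u v
    using arg_cong[OF admissible_flip[OF x that(1)], of "\<lambda>z. B z v"]
      arg_cong[OF admissible_flip[OF x that(1)], of "B v"] that by simp_all
  have "cob x (\<lambda>u v. B (S u) (S v)) + cob (S (S x)) B =
      (\<Sum>i\<in>I. B (S (lb x (N (p i)))) (q i) + B (lb (S (S x)) (p i)) (q i))
    + (\<Sum>i\<in>I. B (p i) (S (lb x (N (q i)))) + B (p i) (lb (S (S x)) (q i)))"
    using intertwine_flip[OF b(1)] intertwine[OF b(2)] by (simp add: cob_def sum.distrib)
  also have "\<dots> = (\<Sum>i\<in>I. B (lb (S x) (N (p i))) (q i) + B (S (lb (S x) (p i))) (q i))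
    + (\<Sum>i\<in>I. B (p i) (lb (S x) (N (q i))) + B (p i) (S (lb (S x) (q i))))"
    by (simp add: t)
  also have "\<dots> = cob (S x) (\<lambda>u v. B (S u) v) + cob (S x) (\<lambda>u v. B u (S v))"
    using intertwine_flip[OF b(3)] intertwine[OF b(4)] by (simp add: cob_def sum.distrib)
  finally show ?thesis .
qed

text \<open>
  Here the intertwining relation is used until the second factor of \<open>r\<close>, resp. the first, is bare.
  What remains is admissibility of \<open>S\<close> in the first slot and the Nijenhuis identity of \<open>N\<close> in the second.
\<close>

lemma cob_coadmissible:
  assumes B: "bilin_form s L B" and x [simp]: "x \<in> L"
  shows "cob (N x) (\<lambda>u v. B (S u) v) + cob x (\<lambda>u v. B u (N (N v))) =
    cob x (\<lambda>u v. B (S u) (N v)) + cob (N x) (\<lambda>u v. B u (N v))"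
proof -
  note [simp] = bilinD[OF B]
  have b: "bilin_form s L (\<lambda>u v. B u (lb (N x) v))" "bilin_form s L (\<lambda>u v. B (lb x u) (N v))"
    "bilin_form s L (\<lambda>u v. B (lb x (S u)) v)" "bilin_form s L (\<lambda>u v. B (S (lb x u)) v)"
    "bilin_form s L (\<lambda>u v. B u (N (lb x v)))" "bilin_form s L (\<lambda>u v. B (lb (N x) u) v)"
    by (simp_all add: bilin_map_def lin_map_def)
  have i: "(\<Sum>i\<in>I. B (lb x (p i)) (N (N (q i)))) = (\<Sum>i\<in>I. B (lb x (S (S (p i)))) (q i))"
    using intertwine[OF b(2)] intertwine[OF b(3)] by simp
  have t: "B (S (lb (N x) u)) v + B (lb x (S (S u))) v = B (lb (N x) (S u)) v + B (S (lb x (S u))) v"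
    "B v (lb (N x) (N u)) + B v (N (N (lb x u))) = B v (N (lb x (N u))) + B v (N (lb (N x) u))"
    if "u \<in> L" "v \<in> L" for u v
  proof -
    show "B (S (lb (N x) u)) v + B (lb x (S (S u))) v = B (lb (N x) (S u)) v + B (S (lb x (S u))) v"
      using arg_cong[OF admissible[OF x that(1)], of "\<lambda>z. B z v"] that by simp
    have "lb (N x) (N u) + N (N (lb x u)) = N (lb x (N u)) + N (lb (N x) u)"
      using nijenhuis[OF x that(1)] that by simp
    from arg_cong[OF this, of "B v"] 
    show "B v (lb (N x) (N u)) + B v (N (N (lb x u))) = B v (N (lb x (N u))) + B v (N (lb (N x) u))"
      using that by simp
  qed
  have "cob (N x) (\<lambda>u v. B (S u) v) + cob x (\<lambda>u v. B u (N (N v))) =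
      (\<Sum>i\<in>I. B (S (lb (N x) (p i))) (q i) + B (lb x (S (S (p i)))) (q i))
    + (\<Sum>i\<in>I. B (p i) (lb (N x) (N (q i))) + B (p i) (N (N (lb x (q i)))))"
    using intertwine[OF b(1)] i by (simp add: cob_def sum.distrib)
  also have "\<dots> = (\<Sum>i\<in>I. B (lb (N x) (S (p i))) (q i) + B (S (lb x (S (p i)))) (q i))
    + (\<Sum>i\<in>I. B (p i) (N (lb x (N (q i)))) + B (p i) (N (lb (N x) (q i))))"
    by (simp add: t)
  also have "\<dots> = cob x (\<lambda>u v. B (S u) (N v)) + cob (N x) (\<lambda>u v. B u (N v))"
    using intertwine[OF b(4)] intertwine[OF b(5)] intertwine[OF b(6)] by (simp add: cob_def sum.distrib)
  finally show ?thesis .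
qed

end

section \<open>Twisted coboundaries\<close>

text \<open>
  The cobracket \<open>\<Delta>\<close> is the Yau twist \<open>(\<alpha> \<otimes> \<beta>) \<delta>\<close> of a coboundary for the untwisted bracket.  Each axiom is
  transported by pushing \<open>\<alpha>\<close> and \<open>\<beta>\<close> through \<open>\<delta>\<close> (they are automorphisms fixing the tensor) and
  cancelling squares.
\<close>

locale coboundary_bihom_lie = involutive_bihom_lie s L br \<alpha> \<beta>
  for s :: "'k::field \<Rightarrow> 'v::ab_group_add \<Rightarrow> 'v" and L br \<alpha> \<beta> +
  fixes I :: "'i set" and p q :: "'i \<Rightarrow> 'v" and N S :: "'v \<Rightarrow> 'v"
    and \<Delta> :: "'v \<Rightarrow> ('k, 'v) tensor2"
  assumes tensor: "intertwined_skew_tensor s L lie I p q N S"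
    and cybe: "trilin_form s L T \<Longrightarrow> skew_tensor.dsum I p q
      (\<lambda>a b c d. T (lie a c) b d + T a (lie b c) d + T a c (lie b d)) = 0"
    and \<alpha>_inv: "bilin_form s L B \<Longrightarrow> (\<Sum>i\<in>I. B (\<alpha> (p i)) (\<alpha> (q i))) = (\<Sum>i\<in>I. B (p i) (q i))"
    and \<beta>_inv: "bilin_form s L B \<Longrightarrow> (\<Sum>i\<in>I. B (\<beta> (p i)) (\<beta> (q i))) = (\<Sum>i\<in>I. B (p i) (q i))"
    and N_comm [simp]: "x \<in> L \<Longrightarrow> N (\<alpha> x) = \<alpha> (N x)" "x \<in> L \<Longrightarrow> N (\<beta> x) = \<beta> (N x)"
    and S_comm [simp]: "x \<in> L \<Longrightarrow> S (\<alpha> x) = \<alpha> (S x)" "x \<in> L \<Longrightarrow> S (\<beta> x) = \<beta> (S x)"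
    and \<Delta>_in [simp]: "x \<in> L \<Longrightarrow> \<Delta> x \<in> tensor_square s L"
    and \<Delta>_cob: "x \<in> L \<Longrightarrow> bilin_form s L B \<Longrightarrow>
      \<Delta> x B = skew_tensor.cob lie I p q x (\<lambda>u v. B (\<alpha> u) (\<beta> v))"
begin

sublocale T: intertwined_skew_tensor s L lie I p q N S by (rule tensor)

lemma cob_\<alpha>:
  "bilin_form s L B \<Longrightarrow> x \<in> L \<Longrightarrow> T.cob (\<alpha> x) B = T.cob x (\<lambda>u v. B (\<alpha> u) (\<alpha> v))"
  by (rule T.cob_equivariant[OF \<alpha>_lin]) (simp_all add: \<alpha>_lie \<alpha>_inv)

lemma cob_\<beta>:
  "bilin_form s L B \<Longrightarrow> x \<in> L \<Longrightarrow> T.cob (\<beta> x) B = T.cob x (\<lambda>u v. B (\<beta> u) (\<beta> v))"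
  by (rule T.cob_equivariant[OF \<beta>_lin]) (simp_all add: \<beta>_lie \<beta>_inv)


lemma twist_form: "bilin_form s L B \<Longrightarrow> bilin_form s L (\<lambda>u v. B (\<alpha> u) (\<beta> v))"
  by (rule bilin_form_comp[OF \<alpha>_lin \<beta>_lin])

lemma \<Delta>_eqI:
  assumes "t \<in> tensor_square s L" "x \<in> L"
    "\<And>B. bilin_form s L B \<Longrightarrow> T.cob x (\<lambda>u v. B (\<alpha> u) (\<beta> v)) = t B"
  shows "\<Delta> x = t"
proof
  fix B show "\<Delta> x B = t B"
    using assms by (cases "bilin_form s L B") (simp_all add: \<Delta>_cob tensor_not_bilin)
qed

lemma \<Delta>_lin: "lin_map s L fscale (tensor_square s L) \<Delta>"
proof -
  have "\<Delta> (x + y) = \<Delta> x + \<Delta> y" if "x \<in> L" "y \<in> L" for x y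
    using that by (intro \<Delta>_eqI TS.subspace_add[OF subspace_tensor_square])
      (simp_all add: \<Delta>_cob T.cob_add twist_form)
  moreover have "\<Delta> (s c x) = fscale c (\<Delta> x)" if "x \<in> L" for c x
    using that by (intro \<Delta>_eqI TS.subspace_scale[OF subspace_tensor_square])
      (simp_all add: \<Delta>_cob T.cob_scale twist_form fscale_def)
  ultimately show ?thesis by (simp add: lin_map_def)
qed

lemma tmap2_\<Delta>:
  assumes "lin_endo s L f" "lin_endo s L g" "x \<in> L" "bilin_form s L B"
  shows "tmap2 s L f g (\<Delta> x) B = T.cob x (\<lambda>u v. B (f (\<alpha> u)) (g (\<beta> v)))"
  using assms \<Delta>_cob[OF assms(3) bilin_form_comp[OF assms(1,2,4)]] by (simp add: tmap2_def)

lemma \<Delta>_\<alpha>: assumes "x \<in> L" shows "\<Delta> (\<alpha> x) = tmap2 s L \<alpha> \<alpha> (\<Delta> x)"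
proof (rule \<Delta>_eqI)
  fix B assume B: "bilin_form s L B"
  show "T.cob (\<alpha> x) (\<lambda>u v. B (\<alpha> u) (\<beta> v)) = tmap2 s L \<alpha> \<alpha> (\<Delta> x) B"
    unfolding cob_\<alpha>[OF twist_form[OF B] assms] tmap2_\<Delta>[OF \<alpha>_lin \<alpha>_lin assms B]
    by (rule T.cob_cong) (simp_all add: assms)
qed (simp_all add: assms tmap2_in \<alpha>_lin)

lemma \<Delta>_\<beta>: assumes "x \<in> L" shows "\<Delta> (\<beta> x) = tmap2 s L \<beta> \<beta> (\<Delta> x)"
proof (rule \<Delta>_eqI)
  fix B assume B: "bilin_form s L B"
  show "T.cob (\<beta> x) (\<lambda>u v. B (\<alpha> u) (\<beta> v)) = tmap2 s L \<beta> \<beta> (\<Delta> x) B"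
    unfolding cob_\<beta>[OF twist_form[OF B] assms] tmap2_\<Delta>[OF \<beta>_lin \<beta>_lin assms B]
    by (rule T.cob_cong) (simp_all add: assms)
qed (simp_all add: assms tmap2_in \<beta>_lin)

lemma \<Delta>_skew:
  assumes x: "x \<in> L"
  shows "tmap2 s L \<beta> \<alpha> (\<Delta> x) + flip2 (tmap2 s L \<beta> \<alpha> (\<Delta> x)) = 0"
proof
  fix B
  show "(tmap2 s L \<beta> \<alpha> (\<Delta> x) + flip2 (tmap2 s L \<beta> \<alpha> (\<Delta> x))) B = 0 B"
  proof (cases "bilin_form s L B")
    case True
    then have B': "bilin_form s L (\<lambda>u v. B v u)" by (rule bilin_form_swap[THEN iffD2])
    note [simp] = bilinD[OF True]
    have c: "bilin_form s L (\<lambda>u v. B (\<beta> (\<alpha> u)) (\<beta> (\<alpha> v)))"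
      by (simp add: bilin_map_def lin_map_def)
    have "T.cob x (\<lambda>u v. B (\<beta> (\<alpha> u)) (\<alpha> (\<beta> v))) = T.cob x (\<lambda>u v. B (\<beta> (\<alpha> u)) (\<beta> (\<alpha> v)))"
      "T.cob x (\<lambda>u v. B (\<alpha> (\<beta> v)) (\<beta> (\<alpha> u))) = T.cob x (\<lambda>u v. B (\<beta> (\<alpha> v)) (\<beta> (\<alpha> u)))"
      by (rule T.cob_cong; simp add: x)+
    with tmap2_\<Delta>[OF \<beta>_lin \<alpha>_lin x True] tmap2_\<Delta>[OF \<beta>_lin \<alpha>_lin x B'] T.cob_swap[OF c x]
    show ?thesis by (simp add: flip2_def)
  qed (simp add: tmap2_def flip2_def bilin_form_swap[of s L B])
qed

text \<open>
  The twists collapse: \<open>(id \<otimes> \<beta> \<otimes> \<alpha>)(\<beta>\<^sup>2 \<otimes> \<Delta>)\<Delta> = (\<alpha> \<otimes> \<alpha> \<otimes> \<alpha>)(id \<otimes> \<delta>)\<delta>\<close>, which reduces the co-Jacobi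
  identity to the untwisted one for the form \<open>T(\<alpha>, \<alpha>, \<alpha>)\<close>.
\<close>

lemma cojac_cob:
  assumes x: "x \<in> L" and T: "trilin_form s L T"
  shows "cojac s L \<Delta> \<alpha> \<beta> x T = T.cob x (\<lambda>y z. T.cob z (\<lambda>u v. T (\<alpha> y) (\<alpha> u) (\<alpha> v)))"
proof -
  note [simp] = trilinD[OF T] x
  have inner: "\<Delta> z (\<lambda>u v. T (\<beta> (\<beta> y)) (\<beta> u) (\<alpha> v)) = T.cob z (\<lambda>u v. T y (\<beta> (\<alpha> u)) (\<beta> (\<alpha> v)))"
    if "y \<in> L" "z \<in> L" for y z
  proof -
    have "bilin_form s L (\<lambda>u v. T (\<beta> (\<beta> y)) (\<beta> u) (\<alpha> v))"
      using that by (simp add: bilin_map_def lin_map_def)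
    from \<Delta>_cob[OF that(2) this] that show ?thesis by (simp cong: T.cob_cong)
  qed
  have T': "trilin_form s L (\<lambda>y u v. T y (\<beta> (\<alpha> u)) (\<beta> (\<alpha> v)))"
    by (simp add: trilin_form_def bilin_map_def lin_map_def)
  have "cojac s L \<Delta> \<alpha> \<beta> x T = \<Delta> x (\<lambda>y z. \<Delta> z (\<lambda>u v. T (\<beta> (\<beta> y)) (\<beta> u) (\<alpha> v)))"
    by (rule cojac_apply[OF \<alpha>_lin \<beta>_lin T])
  also have "\<dots> = \<Delta> x (\<lambda>y z. T.cob z (\<lambda>u v. T y (\<beta> (\<alpha> u)) (\<beta> (\<alpha> v))))"
    by (rule tensor_cong[OF \<Delta>_in[OF x] inner])
  also have "\<dots> = T.cob x (\<lambda>y z. T.cob (\<beta> z) (\<lambda>u v. T (\<alpha> y) (\<beta> (\<alpha> u)) (\<beta> (\<alpha> v))))"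
    by (rule \<Delta>_cob[OF x T.bilin_cob[OF T']])
  also have "\<dots> = T.cob x (\<lambda>y z. T.cob z (\<lambda>u v. T (\<alpha> y) (\<alpha> u) (\<alpha> v)))"
  proof (rule T.cob_cong[OF x])
    fix y z assume yz: "y \<in> L" "z \<in> L"
    then have "bilin_form s L (\<lambda>u v. T (\<alpha> y) (\<beta> (\<alpha> u)) (\<beta> (\<alpha> v)))"
      by (simp add: bilin_map_def lin_map_def)
    from cob_\<beta>[OF this yz(2)]
    have "T.cob (\<beta> z) (\<lambda>u v. T (\<alpha> y) (\<beta> (\<alpha> u)) (\<beta> (\<alpha> v)))
      = T.cob z (\<lambda>u v. T (\<alpha> y) (\<beta> (\<alpha> (\<beta> u))) (\<beta> (\<alpha> (\<beta> v))))" .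
    also have "\<dots> = T.cob z (\<lambda>u v. T (\<alpha> y) (\<alpha> u) (\<alpha> v))"
      by (rule T.cob_cong) (use yz in simp_all)
    finally show "T.cob (\<beta> z) (\<lambda>u v. T (\<alpha> y) (\<beta> (\<alpha> u)) (\<beta> (\<alpha> v)))
      = T.cob z (\<lambda>u v. T (\<alpha> y) (\<alpha> u) (\<alpha> v))" .
  qed
  finally show ?thesis .
qed

lemma \<Delta>_cojacobi:
  assumes x: "x \<in> L"
  shows "cojac s L \<Delta> \<alpha> \<beta> x + flip12 (flip23 (cojac s L \<Delta> \<alpha> \<beta> x))
    + flip23 (flip12 (cojac s L \<Delta> \<alpha> \<beta> x)) = 0"
proof
  fix T
  have perm: "trilin_form s L (\<lambda>u w z. T z u w) = trilin_form s L T"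
    "trilin_form s L (\<lambda>u w z. T w z u) = trilin_form s L T"
    unfolding trilin_form_def bilin_map_def by auto
  show "(cojac s L \<Delta> \<alpha> \<beta> x + flip12 (flip23 (cojac s L \<Delta> \<alpha> \<beta> x))
    + flip23 (flip12 (cojac s L \<Delta> \<alpha> \<beta> x))) T = 0 T"
  proof (cases "trilin_form s L T")
    case True
    then show ?thesis
      using T.cob_cojacobi[OF cybe trilin_form_comp[OF \<alpha>_lin \<alpha>_lin \<alpha>_lin True] x]
      by (simp add: flip12_def flip23_def cojac_cob[OF x] perm)
  next
    case False
    then have "cojac s L \<Delta> \<alpha> \<beta> x T' = 0" if "\<not> trilin_form s L T'" for T'
      using that by (simp add: cojac_def tmap3_def)
    then show ?thesis using False by (simp add: flip12_def flip23_def perm)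
  qed
qed

lemma coalgebra: "bihom_lie_coalgebra s L \<Delta> \<alpha> \<beta>"
  unfolding bihom_lie_coalgebra_def Let_def
  using fd \<alpha>_lin \<beta>_lin \<alpha>\<beta> \<Delta>_lin \<Delta>_\<alpha> \<Delta>_\<beta> \<Delta>_skew \<Delta>_cojacobi by blast

lemma lin_br: "x \<in> L \<Longrightarrow> lin_endo s L (br x)"
  by (simp add: lin_map_def)

text \<open>
  The BiHom action of \<open>x\<close> on \<open>\<Delta>(y)\<close> is the twist of the Lie action of \<open>\<beta> x\<close> on \<open>\<delta>(\<beta> y)\<close>; as
  \<open>[\<alpha> \<beta> x, y] = lie (\<beta> x) (\<beta> y)\<close>, the bialgebra condition becomes the cocycle identity of \<open>\<delta>\<close>.
\<close>

lemma ad_\<Delta>: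
  assumes x: "x \<in> L" and y: "y \<in> L" and B: "bilin_form s L B"
  shows "(tmap2 s L (br (\<beta> x)) \<beta> (\<Delta> y) + tmap2 s L \<beta> (br (\<alpha> x)) (\<Delta> y)) B =
    T.cob (\<beta> y) (\<lambda>u v. B (\<alpha> (lie (\<beta> x) u)) (\<beta> v) + B (\<alpha> u) (\<beta> (lie (\<beta> x) v)))"
proof -
  note [simp] = bilinD[OF B] x y
  have "bilin_form s L (\<lambda>u v. B (\<alpha> (lie (\<beta> x) u)) (\<beta> v) + B (\<alpha> u) (\<beta> (lie (\<beta> x) v)))"
    by (simp add: bilin_map_def lin_map_def algebra_simps)
  from cob_\<beta>[OF this y] have "T.cob (\<beta> y) (\<lambda>u v. B (\<alpha> (lie (\<beta> x) u)) (\<beta> v) + B (\<alpha> u) (\<beta> (lie (\<beta> x) v)))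
    = T.cob y (\<lambda>u v. B (\<alpha> (lie (\<beta> x) (\<beta> u))) (\<beta> (\<beta> v)) + B (\<alpha> (\<beta> u)) (\<beta> (lie (\<beta> x) (\<beta> v))))" .
  also have "\<dots> = T.cob y (\<lambda>u v. B (br (\<beta> x) (\<alpha> u)) (\<beta> (\<beta> v)) + B (\<beta> (\<alpha> u)) (br (\<alpha> x) (\<beta> v)))"
    by (rule T.cob_cong) (simp_all add: br_eq_lie \<alpha>_lie \<beta>_lie)
  finally show ?thesis
    by (simp add: tmap2_\<Delta>[OF _ _ y B] lin_br \<alpha>_lin \<beta>_lin T.cob_form_add)
qed

lemma bialgebra: "bihom_lie_bialgebra s L br \<Delta> \<alpha> \<beta>"
proof -
  have "\<Delta> (br (\<alpha> (\<beta> x)) y) =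
      (tmap2 s L (br (\<beta> x)) \<beta> (\<Delta> y) + tmap2 s L \<beta> (br (\<alpha> x)) (\<Delta> y))
      - (tmap2 s L (br (\<beta> y)) \<beta> (\<Delta> x) + tmap2 s L \<beta> (br (\<alpha> y)) (\<Delta> x))"
    if [simp]: "x \<in> L" "y \<in> L" for x y
  proof (rule \<Delta>_eqI)
    fix B assume B: "bilin_form s L B"
    have "br (\<alpha> (\<beta> x)) y = lie (\<beta> x) (\<beta> y)" by (simp add: br_eq_lie)
    then show "T.cob (br (\<alpha> (\<beta> x)) y) (\<lambda>u v. B (\<alpha> u) (\<beta> v)) =
      ((tmap2 s L (br (\<beta> x)) \<beta> (\<Delta> y) + tmap2 s L \<beta> (br (\<alpha> x)) (\<Delta> y))
      - (tmap2 s L (br (\<beta> y)) \<beta> (\<Delta> x) + tmap2 s L \<beta> (br (\<alpha> y)) (\<Delta> x))) B"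
      using ad_\<Delta>[OF that B] ad_\<Delta>[OF that(2,1) B] T.cob_cocycle[OF twist_form[OF B], of "\<beta> x" "\<beta> y"]
      by simp
  qed (auto intro!: TS.subspace_add TS.subspace_diff subspace_tensor_square tmap2_in lin_br
      simp: \<alpha>_lin \<beta>_lin)
  then show ?thesis
    unfolding bihom_lie_bialgebra_def Let_def using alg coalgebra bij_\<alpha> by simp
qed

lemma nijenhuis_coalgebra: "nijenhuis_bihom_lie_coalgebra s L \<Delta> S \<alpha> \<beta>"
proof -
  have id: "lin_endo s L id" by (simp add: lin_map_def)
  have "tmap2 s L S S (\<Delta> x) + \<Delta> (S (S x)) = tmap2 s L S id (\<Delta> (S x)) + tmap2 s L id S (\<Delta> (S x))"
    if [simp]: "x \<in> L" for x
  proof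
    fix B show "(tmap2 s L S S (\<Delta> x) + \<Delta> (S (S x))) B =
      (tmap2 s L S id (\<Delta> (S x)) + tmap2 s L id S (\<Delta> (S x))) B"
    proof (cases "bilin_form s L B")
      case True
      have "T.cob x (\<lambda>u v. B (S (\<alpha> u)) (S (\<beta> v))) = T.cob x (\<lambda>u v. B (\<alpha> (S u)) (\<beta> (S v)))"
        "T.cob (S x) (\<lambda>u v. B (S (\<alpha> u)) (\<beta> v)) = T.cob (S x) (\<lambda>u v. B (\<alpha> (S u)) (\<beta> v))"
        "T.cob (S x) (\<lambda>u v. B (\<alpha> u) (S (\<beta> v))) = T.cob (S x) (\<lambda>u v. B (\<alpha> u) (\<beta> (S v)))"
        by (rule T.cob_cong; simp)+
      with T.cob_conijenhuis[OF twist_form[OF True] that] True show ?thesis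
        by (simp add: tmap2_\<Delta> \<Delta>_cob id T.S_lin)
    qed (simp add: tmap2_def tensor_not_bilin[OF \<Delta>_in])
  qed
  then show ?thesis using coalgebra T.S_lin by (simp add: nijenhuis_bihom_lie_coalgebra_def)
qed

lemma dual_involutive_nijenhuis:
  "involutive_nijenhuis_bihom_lie_algebra fscale (dual s L) (dual_cobr L \<Delta>)
    (dual_map L S) (dual_map L \<alpha>) (dual_map L \<beta>)"
proof -
  interpret C: bihom_lie_coalg s L \<Delta> \<alpha> \<beta> by unfold_locales (rule coalgebra)
  have "dual_map L \<alpha> (dual_map L \<alpha> a) = a" "dual_map L \<beta> (dual_map L \<beta> a) = a" if "a \<in> dual s L" for a
    using that by (auto simp: dual_map_def dual_def fun_eq_iff)
  then show ?thesis
    unfolding involutive_nijenhuis_bihom_lie_algebra_def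
    using C.dual_nijenhuis[OF nijenhuis_coalgebra] by simp
qed

lemma dual_adjoint_admissible:
  "adjoint_admissible fscale (dual s L) (dual_cobr L \<Delta>)
    (dual_map L S) (dual_map L \<alpha>) (dual_map L \<beta>) (dual_map L N)"
proof -
  interpret C: bihom_lie_coalg s L \<Delta> \<alpha> \<beta> by unfold_locales (rule coalgebra)
  have "dual_map L N (dual_cobr L \<Delta> (dual_map L S a) b) + dual_cobr L \<Delta> a (dual_map L N (dual_map L N b)) =
    dual_cobr L \<Delta> (dual_map L S a) (dual_map L N b) + dual_map L N (dual_cobr L \<Delta> a (dual_map L N b))"
    if ab: "a \<in> dual s L" "b \<in> dual s L" for a b
  proof
    fix x
    show "(dual_map L N (dual_cobr L \<Delta> (dual_map L S a) b)
      + dual_cobr L \<Delta> a (dual_map L N (dual_map L N b))) x =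
      (dual_cobr L \<Delta> (dual_map L S a) (dual_map L N b)
      + dual_map L N (dual_cobr L \<Delta> a (dual_map L N b))) x"
    proof (cases "x \<in> L")
      case True
      note [simp] = True
      have B: "bilin_form s L (\<lambda>u v. a u * b v)" by (rule bilin_form_product[OF ab])
      have id: "lin_endo s L id" by (simp add: lin_map_def)
      have NN: "lin_endo s L (\<lambda>x. N (N x))" by (simp add: lin_map_def)
      have e: "\<Delta> y (\<lambda>u v. a (f u) * b (g v)) = T.cob y (\<lambda>u v. a (f (\<alpha> u)) * b (g (\<beta> v)))"
        if "lin_endo s L f" "lin_endo s L g" "y \<in> L" for f g y
        using \<Delta>_cob[OF that(3) bilin_form_comp[OF that(1,2) B]] .
      have "\<Delta> (N x) (\<lambda>u v. a (S u) * b v) = T.cob (N x) (\<lambda>u v. a (\<alpha> (S u)) * b (\<beta> v))"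
        using e[OF T.S_lin id, of "N x"] by (simp cong: T.cob_cong)
      moreover have "\<Delta> x (\<lambda>u v. a u * b (N (N v))) = T.cob x (\<lambda>u v. a (\<alpha> u) * b (\<beta> (N (N v))))"
        using e[OF id NN, of x] by (simp cong: T.cob_cong)
      moreover have "\<Delta> x (\<lambda>u v. a (S u) * b (N v)) = T.cob x (\<lambda>u v. a (\<alpha> (S u)) * b (\<beta> (N v)))"
        using e[OF T.S_lin T.N_lin, of x] by (simp cong: T.cob_cong)
      moreover have "\<Delta> (N x) (\<lambda>u v. a u * b (N v)) = T.cob (N x) (\<lambda>u v. a (\<alpha> u) * b (\<beta> (N v)))"
        using e[OF id T.N_lin, of "N x"] by (simp cong: T.cob_cong)
      moreover have "dual_cobr L \<Delta> a (dual_map L N (dual_map L N b)) x = \<Delta> x (\<lambda>u v. a u * b (N (N v)))"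
        unfolding C.dbr_apply[OF True] by (rule tensor_cong) (simp_all add: dual_map_def)
      moreover have "dual_map L N (dual_cobr L \<Delta> (dual_map L S a) b) x = \<Delta> (N x) (\<lambda>u v. a (S u) * b v)"
        "dual_map L N (dual_cobr L \<Delta> a (dual_map L N b)) x = \<Delta> (N x) (\<lambda>u v. a u * b (N v))"
        by (simp_all add: dual_map_def[of L N "dual_cobr _ _ _ _"] C.dbr_dual_map_left C.dbr_dual_map_right)
      moreover have "dual_cobr L \<Delta> (dual_map L S a) (dual_map L N b) x = \<Delta> x (\<lambda>u v. a (S u) * b (N v))"
        by (rule C.dbr_dual_map[OF True])
      ultimately show ?thesis
        using T.cob_coadmissible[OF twist_form[OF B] True] by (simp only: plus_fun_apply)
    qed (simp add: dual_map_def dual_cobr_def)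
  qed
  moreover have "dual_map L N (dual_map L \<alpha> a) = dual_map L \<alpha> (dual_map L N a)"
    "dual_map L N (dual_map L \<beta> a) = dual_map L \<beta> (dual_map L N a)" for a
    by (rule dual_map_commute; simp)+
  ultimately show ?thesis
    using adjoint_admissible_iff[OF dual_involutive_nijenhuis lin_dual_map[OF T.N_lin carrier_space_axioms]]
    by blast
qed

end

section \<open>The Nijenhuis BiHom-Lie bialgebra of a solution\<close>

theorem theorem2p54:
  fixes s :: "'k::field \<Rightarrow> 'v::ab_group_add \<Rightarrow> 'v" and L :: "'v set"
    and br :: "'v \<Rightarrow> 'v \<Rightarrow> 'v" and N S \<alpha> \<beta> :: "'v \<Rightarrow> 'v" and r :: "('k, 'v) tensor2"
  assumes "involutive_nijenhuis_bihom_lie_algebra s L br N \<alpha> \<beta>"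
    and "lin_endo s L S"
    and "adjoint_admissible s L br N \<alpha> \<beta> S"
    and "r \<in> tensor_square s L"
    and "solves_S_Nijenhuis_CBHYBE s L br N \<alpha> \<beta> S r"
    and "r = - flip2 r"
    and "tmap2 s L \<alpha> \<alpha> r = r"
    and "tmap2 s L \<beta> \<beta> r = r"
  shows "nijenhuis_bihom_lie_bialgebra s L br N (cobr_of s L br \<alpha> \<beta> r) S \<alpha> \<beta>"
proof -
  interpret involutive_bihom_lie s L br \<alpha> \<beta>
    using assms(1) by unfold_locales
      (auto simp: involutive_nijenhuis_bihom_lie_algebra_def nijenhuis_bihom_lie_algebra_def)
  have N: "lin_endo s L N" and N_comm [simp]: "\<And>x. x \<in> L \<Longrightarrow> N (\<alpha> x) = \<alpha> (N x)"
      "\<And>x. x \<in> L \<Longrightarrow> N (\<beta> x) = \<beta> (N x)"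
    and nij: "\<And>x y. x \<in> L \<Longrightarrow> y \<in> L \<Longrightarrow>
      br (N x) (N y) = N (br (N x) y + br x (N y)) - N (N (br x y))"
    using assms(1) unfolding involutive_nijenhuis_bihom_lie_algebra_def nijenhuis_bihom_lie_algebra_def
    by blast+
  have S_comm [simp]: "\<And>x. x \<in> L \<Longrightarrow> S (\<alpha> x) = \<alpha> (S x)" "\<And>x. x \<in> L \<Longrightarrow> S (\<beta> x) = \<beta> (S x)"
    and adm: "\<And>x y. x \<in> L \<Longrightarrow> y \<in> L \<Longrightarrow>
      S (br (N x) y) + br x (S (S y)) = br (N x) (S y) + S (br x (S y))"
    using assms(3) unfolding adjoint_admissible_iff[OF assms(1,2)] by blast+
  note [simp] = linD[OF N] linD[OF assms(2)]
  note bil = bilin_map_def lin_map_def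
  obtain n :: nat and x y where xy [simp]: "\<And>i. x i \<in> L" "\<And>i. y i \<in> L"
    and r: "r = (\<Sum>i<n. pure2 s L (x i) (y i))"
    using tensor_square_as_sum[OF assms(4)] by blast
  have id: "lin_endo s L id" by (simp add: lin_map_def)
  have r_apply: "r B = (\<Sum>i<n. B (x i) (y i))" if "bilin_form s L B" for B
    using that by (simp add: r sum_pure2_eval)
  have tmap2_r: "tmap2 s L f g r B = (\<Sum>i<n. B (f (x i)) (g (y i)))"
    if "lin_endo s L f" "lin_endo s L g" "bilin_form s L B" for f g B
    using r_apply[OF bilin_form_comp[OF that]] that by (simp add: tmap2_def)
  have r_skew: "(\<Sum>i<n. B (y i) (x i)) = - (\<Sum>i<n. B (x i) (y i))" if B: "bilin_form s L B" for B
    using fun_cong[OF assms(6), of B] r_apply[OF B] r_apply[OF bilin_form_swap[THEN iffD2, OF B]]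
    by (simp add: flip2_def)
  have r_\<alpha>: "(\<Sum>i<n. B (\<alpha> (x i)) (\<alpha> (y i))) = (\<Sum>i<n. B (x i) (y i))" if "bilin_form s L B" for B
    using tmap2_r[OF \<alpha>_lin \<alpha>_lin that] r_apply[OF that] assms(7) by simp
  have r_\<beta>: "(\<Sum>i<n. B (\<beta> (x i)) (\<beta> (y i))) = (\<Sum>i<n. B (x i) (y i))" if "bilin_form s L B" for B
    using tmap2_r[OF \<beta>_lin \<beta>_lin that] r_apply[OF that] assms(8) by simp
  have r_\<gamma>: "(\<Sum>i<n. B (\<beta> (\<alpha> (x i))) (\<beta> (\<alpha> (y i)))) = (\<Sum>i<n. B (x i) (y i))"
    if B: "bilin_form s L B" for B
    using r_\<alpha>[OF bilin_form_comp[OF \<beta>_lin \<beta>_lin B]] r_\<beta>[OF B] by simp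
  have r_SN: "(\<Sum>i<n. B (S (x i)) (y i)) = (\<Sum>i<n. B (x i) (N (y i)))" if "bilin_form s L B" for B
    using assms(5) fun_cong[of "tmap2 s L S id r - tmap2 s L id N r" 0 B]
      tmap2_r[OF assms(2) id that] tmap2_r[OF id N that]
    by (simp add: solves_S_Nijenhuis_CBHYBE_def)
  \<comment> \<open>The untwisted solution is \<open>(\<alpha>\<beta> \<otimes> id) r\<close>: moving \<open>\<alpha>\<beta>\<close> into one factor turns
      CBHYB into the classical Yang-Baxter expression.\<close>
  define p where "p i = \<beta> (\<alpha> (x i))" for i
  have p_in [simp]: "p i \<in> L" for i by (simp add: p_def)
  have tensor: "intertwined_skew_tensor s L lie {..<n} p y N S"
  proof unfold_locales
    fix B assume B: "bilin_form s L B"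
    note [simp] = bilinD[OF B]
    have b: "bilin_form s L (\<lambda>u v. B u (\<beta> (\<alpha> v)))" "bilin_form s L (\<lambda>u v. B (\<beta> (\<alpha> u)) v)"
      by (simp_all add: bil)
    show "(\<Sum>i<n. B (y i) (p i)) = - (\<Sum>i<n. B (p i) (y i))"
      using r_skew[OF b(1)] r_\<gamma>[OF b(1)] by (simp add: p_def)
    show "(\<Sum>i<n. B (S (p i)) (y i)) = (\<Sum>i<n. B (p i) (N (y i)))"
      using r_SN[OF b(2)] by (simp add: p_def)
  next
    fix u v assume [simp]: "u \<in> L" "v \<in> L"
    show "lie (N u) (N v) = N (lie (N u) v + lie u (N v)) - N (N (lie u v))"
      using nij[of "\<alpha> u" "\<beta> v"] by (simp add: lie_def)
    show "S (lie (N u) v) + lie u (S (S v)) = lie (N u) (S v) + S (lie u (S v))"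
      using adm[of "\<alpha> u" "\<beta> v"] by (simp add: lie_def)
  qed (simp_all add: N assms(2))
  interpret T: intertwined_skew_tensor s L lie "{..<n}" p y N S by (rule tensor)
  have cybe: "T.dsum (\<lambda>a b c d. T (lie a c) b d + T a (lie b c) d + T a c (lie b d)) = 0"
    if T: "trilin_form s L T" for T
  proof -
    note [simp] = trilinD[OF T]
    \<comment> \<open>The three factors \<open>\<beta>\<close> in CBHYB cancel against those in this form.\<close>
    let ?T = "\<lambda>u v w. T (\<beta> u) (\<beta> v) (\<beta> w)"
    have T': "trilin_form s L ?T" by (rule trilin_form_comp[OF \<beta>_lin \<beta>_lin \<beta>_lin T])
    have b: "bilin_form s L (\<lambda>u v. T u (lie (\<beta> (\<alpha> v)) (p j)) (y j))"
      "bilin_form s L (\<lambda>u v. T u (x j) (lie (\<beta> (\<alpha> v)) (\<beta> (\<alpha> (y j)))))"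
      "bilin_form s L (\<lambda>u v. T (p j) u (lie (y j) (\<beta> (\<alpha> v))))" for j
      by (simp_all add: bil)
    have \<gamma>\<gamma> [simp]: "\<beta> (\<alpha> (\<beta> (\<alpha> u))) = u" if "u \<in> L" for u
      using that \<alpha>\<beta>[of "\<alpha> u"] by simp
    have "CBHYB s L br \<alpha> \<beta> r = 0" using assms(5) by (simp add: solves_S_Nijenhuis_CBHYBE_def)
    then have "CBHYB s L br \<alpha> \<beta> r ?T = 0" by simp
    then have "(\<Sum>i<n. \<Sum>j<n. ?T (br (x i) (\<alpha> (\<beta> (x j)))) (\<beta> (y i)) (\<beta> (y j))
       + ?T (\<beta> (x i)) (br (y i) (\<alpha> (\<beta> (x j)))) (\<beta> (y j))
       + ?T (\<beta> (x i)) (\<beta> (x j)) (br (y i) (\<alpha> (\<beta> (y j))))) = 0"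
      unfolding r CBHYB_sum[OF br_bilin \<alpha>_lin bij_\<alpha> \<beta>_lin vs sub xy]
      using T' by (simp add: sum_fun_apply pure3_def)
    then have "(\<Sum>i<n. \<Sum>j<n. T (lie (p i) (p j)) (y i) (y j)
       + T (x i) (lie (\<beta> (\<alpha> (y i))) (p j)) (y j)
       + T (x i) (x j) (lie (\<beta> (\<alpha> (y i))) (\<beta> (\<alpha> (y j))))) = 0"
      by (simp add: br_eq_lie \<beta>_lie p_def)
    \<comment> \<open>Invariance of \<open>r\<close> under \<open>\<alpha>\<beta> \<otimes> \<alpha>\<beta>\<close> moves \<open>\<alpha>\<beta>\<close> from the second factor to the first.\<close>
    moreover have "(\<Sum>i<n. \<Sum>j<n. T (x i) (lie (\<beta> (\<alpha> (y i))) (p j)) (y j)) =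
      (\<Sum>i<n. \<Sum>j<n. T (p i) (lie (y i) (p j)) (y j))"
      by (subst (1 2) sum.swap) (use r_\<gamma>[OF b(1)] in \<open>simp add: p_def\<close>)
    moreover have "(\<Sum>i<n. \<Sum>j<n. T (x i) (x j) (lie (\<beta> (\<alpha> (y i))) (\<beta> (\<alpha> (y j))))) =
      (\<Sum>i<n. \<Sum>j<n. T (p i) (x j) (lie (y i) (\<beta> (\<alpha> (y j)))))"
      by (subst (1 2) sum.swap) (use r_\<gamma>[OF b(2)] in \<open>simp add: p_def\<close>)
    moreover have "(\<Sum>i<n. \<Sum>j<n. T (p i) (x j) (lie (y i) (\<beta> (\<alpha> (y j))))) =
      (\<Sum>i<n. \<Sum>j<n. T (p i) (p j) (lie (y i) (y j)))"
      using r_\<gamma>[OF b(3)] by (simp add: p_def)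
    ultimately show ?thesis by (simp add: T.dsum_def sum.distrib)
  qed
  have lin_ad: "lin_endo s L (br u)" if "u \<in> L" for u
    using that by (simp add: bil)
  have cobr: "cobr_of s L br \<alpha> \<beta> r u B = T.cob u (\<lambda>v w. B (\<alpha> v) (\<beta> w))"
    if [simp]: "u \<in> L" and B: "bilin_form s L B" for u B
    by (simp add: cobr_of_def tmap2_r lin_ad \<beta>_lin B T.cob_def sum.distrib p_def br_eq_lie \<alpha>_lie \<beta>_lie)
  interpret coboundary_bihom_lie s L br \<alpha> \<beta> "{..<n}" p y N S "cobr_of s L br \<alpha> \<beta> r"
  proof unfold_locales
    fix B assume B: "bilin_form s L B"
    note [simp] = bilinD[OF B]
    have b: "bilin_form s L (\<lambda>u v. B (\<beta> (\<alpha> u)) v)"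
      by (simp add: bil)
    show "(\<Sum>i<n. B (\<alpha> (p i)) (\<alpha> (y i))) = (\<Sum>i<n. B (p i) (y i))"
      using r_\<alpha>[OF b] by (simp add: p_def)
    show "(\<Sum>i<n. B (\<beta> (p i)) (\<beta> (y i))) = (\<Sum>i<n. B (p i) (y i))"
      using r_\<beta>[OF b] by (simp add: p_def)
  next
    fix u assume "u \<in> L"
    then show "cobr_of s L br \<alpha> \<beta> r u \<in> tensor_square s L"
      unfolding cobr_of_def
      by (intro TS.subspace_add subspace_tensor_square tmap2_in assms(4) \<beta>_lin lin_ad) simp_all
  qed (simp_all add: cybe cobr)
  show ?thesis
    unfolding nijenhuis_bihom_lie_bialgebra_def
    using bialgebra assms(1,3) nijenhuis_coalgebra dual_adjoint_admissible by blast
qed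

end
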